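(* For $r,s\in(0,1)$ with $r\neq s$, $\mathcal{M}_{f_r}\neq\mathcal{M}_{f_s}$ (as sets of functions on $\mathbb{D}$), where $$f_r(z)=\frac{1}{\sqrt2}\left(z^2,\,b_r(z)^2\right),\qquad b_r(z)=\frac{z-r}{1-rz}.$$
   Context: Notation: $\mathbb{D}$ is the open unit disc, $\mathbb{B}_d$ the open Euclidean unit ball of $\mathbb{C}^d$, with $\langle z,w\rangle=\sum_j z_j\overline{w_j}$. The Drury-Arveson space $H^2_d$ is the reproducing kernel Hilbert space (RKHS) on $\mathbb{B}_d$ with kernel $\kappa_w(z)=\frac{1}{1-\langle z,w\rangle}$; $\mathcal{M}_d=\operatorname{Mult}(H^2_d)$ is its multiplier algebra. A variety in $\mathbb{B}_d$ is a set of the form $\{z\in\mathbb{B}_d:\varphi(z)=0\ \text{for all}\ \varphi\in E\}$ with $E\subset\mathcal{M}_d$. An analytic disc attached to the unit sphere is a variety $V\subset\mathbb{B}_d$, $d<\infty$, for which there exists an injective analytic map $f:\mathbb{D}\to\mathbb{B}_d$ with $f'(z)\neq 0$ for $z\in\mathbb{D}$, such that $V=f(\mathbb{D})$, $f$ extends to be $C^2$ up to $\overline{\mathbb{D}}$, and for $x\in\overline{\mathbb{D}}$, $\|f(x)\|=1\iff|x|=1$. Such an $f$ is called an embedding map of $V$. It is known that for $r\in(0,1)$ the map $f_r$ is an embedding map of an analytic disc $f_r(\mathbb{D})\subset\mathbb{B}_2$ attached to the unit sphere, with its only self-crossing at $\pm1$. For a variety $V$, $\mathcal{H}_V$ is the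 closed linear span of $\{\kappa_\lambda:\lambda\in V\}$ in $H^2_d$, regarded as an RKHS of functions on $V$, and $\mathcal{M}_V=\{\varphi|_V:\varphi\in\mathcal{M}_d\}$, which equals $\operatorname{Mult}(\mathcal{H}_V)$. If $f$ is an embedding map of $V$, then $\mathcal{M}_f=\{\varphi:\mathbb{D}\to\mathbb{C}:\ \varphi\circ f^{-1}\in\mathcal{M}_V\}$. *)

theory Defs
  imports "HOL-Analysis.Analysis"
begin

text \<open>A function on a set X is represented by its extensional version, i.e. it takes the value
  \<open>undefined\<close> outside X. Equality of such representatives is equality of functions on X.\<close>

locale hilbert_function_space =
  fixes X :: "'a set"
    and H :: "('a \<Rightarrow> complex) set"
    and ip :: "('a \<Rightarrow> complex) \<Rightarrow> ('a \<Rightarrow> complex) \<Rightarrow> complex"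
  assumes functions_on: "H \<subseteq> extensional X"
    and zero_mem: "(\<lambda>z\<in>X. 0) \<in> H"
    and add_mem: "\<And>g h. \<lbrakk>g \<in> H; h \<in> H\<rbrakk> \<Longrightarrow> (\<lambda>z\<in>X. g z + h z) \<in> H"
    and scale_mem: "\<And>c g. g \<in> H \<Longrightarrow> (\<lambda>z\<in>X. c * g z) \<in> H"
    and ip_add: "\<And>g h u. \<lbrakk>g \<in> H; h \<in> H; u \<in> H\<rbrakk>
                   \<Longrightarrow> ip (\<lambda>z\<in>X. g z + h z) u = ip g u + ip h u"
    and ip_scale: "\<And>c g u. \<lbrakk>g \<in> H; u \<in> H\<rbrakk> \<Longrightarrow> ip (\<lambda>z\<in>X. c * g z) u = c * ip g u"
    and ip_cnj: "\<And>g u. \<lbrakk>g \<in> H; u \<in> H\<rbrakk> \<Longrightarrow> ip u g = cnj (ip g u)"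
    and ip_nonneg: "\<And>g. g \<in> H \<Longrightarrow> 0 \<le> Re (ip g g)"
    and ip_definite: "\<And>g. \<lbrakk>g \<in> H; ip g g = 0\<rbrakk> \<Longrightarrow> g = (\<lambda>z\<in>X. 0)"
    and complete:
      "\<And>G :: nat \<Rightarrow> 'a \<Rightarrow> complex.
         \<lbrakk>range G \<subseteq> H;
          \<forall>e>0. \<exists>N. \<forall>m\<ge>N. \<forall>n\<ge>N.
            sqrt (Re (ip (\<lambda>z\<in>X. G m z - G n z) (\<lambda>z\<in>X. G m z - G n z))) < e\<rbrakk>
         \<Longrightarrow> \<exists>g\<in>H. (\<lambda>n. sqrt (Re (ip (\<lambda>z\<in>X. G n z - g z) (\<lambda>z\<in>X. G n z - g z))))
                    \<longlonglongrightarrow> 0"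

text \<open>\<open>K w\<close> is the kernel function at the point w, so \<open>K w z\<close> is \<open>\<kappa>\<^sub>w(z)\<close>.\<close>

locale reproducing_kernel_hilbert_space = hilbert_function_space X H ip
  for X :: "'a set"
    and K :: "'a \<Rightarrow> 'a \<Rightarrow> complex"
    and H :: "('a \<Rightarrow> complex) set"
    and ip :: "('a \<Rightarrow> complex) \<Rightarrow> ('a \<Rightarrow> complex) \<Rightarrow> complex" +
  assumes kernel_mem: "\<And>w. w \<in> X \<Longrightarrow> restrict (K w) X \<in> H"
    and reproducing: "\<And>g w. \<lbrakk>g \<in> H; w \<in> X\<rbrakk> \<Longrightarrow> g w = ip g (restrict (K w) X)"

text \<open>For a positive semidefinite kernel the underlying function space exists and is unique
  (Moore--Aronszajn), so the description below is proper in that case.\<close>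

definition rkhs :: "'a set \<Rightarrow> ('a \<Rightarrow> 'a \<Rightarrow> complex) \<Rightarrow> ('a \<Rightarrow> complex) set" where
  "rkhs X K = (THE H. \<exists>ip. reproducing_kernel_hilbert_space X K H ip)"

definition multipliers :: "'a set \<Rightarrow> ('a \<Rightarrow> complex) set \<Rightarrow> ('a \<Rightarrow> complex) set" where
  "multipliers X H = {\<phi> \<in> extensional X. \<forall>g\<in>H. (\<lambda>z\<in>X. \<phi> z * g z) \<in> H}"

definition cinner :: "complex ^ 'd \<Rightarrow> complex ^ 'd \<Rightarrow> complex" where
  "cinner z w = (\<Sum>j\<in>UNIV. z $ j * cnj (w $ j))"

definition drury_arveson_kernel :: "complex ^ 'd \<Rightarrow> complex ^ 'd \<Rightarrow> complex" where
  "drury_arveson_kernel w z = 1 / (1 - cinner z w)"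

definition drury_arveson_space :: "(complex ^ 'd \<Rightarrow> complex) set" where
  "drury_arveson_space = rkhs (ball 0 1) drury_arveson_kernel"

definition drury_arveson_multipliers :: "(complex ^ 'd \<Rightarrow> complex) set" where
  "drury_arveson_multipliers = multipliers (ball 0 1) drury_arveson_space"

definition variety_multipliers :: "(complex ^ 'd) set \<Rightarrow> (complex ^ 'd \<Rightarrow> complex) set" where
  "variety_multipliers V = (\<lambda>\<phi>. restrict \<phi> V) ` drury_arveson_multipliers"

text \<open>The algebra of functions on the disc obtained by pulling back the multipliers of
  the image of f; it is meant for maps f that are injective on the disc.\<close>

definition disc_multipliers :: "(complex \<Rightarrow> complex ^ 'd) \<Rightarrow> (complex \<Rightarrow> complex) set" where
  "disc_multipliers f =
     {\<phi> \<in> extensional (ball 0 1).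
        restrict (\<phi> \<circ> the_inv_into (ball 0 1) f) (f ` ball 0 1)
          \<in> variety_multipliers (f ` ball 0 1)}"

definition disc_aut :: "real \<Rightarrow> complex \<Rightarrow> complex" where
  "disc_aut r z = (z - of_real r) / (1 - of_real r * z)"

definition crossing_disc :: "real \<Rightarrow> complex \<Rightarrow> complex ^ 2" where
  "crossing_disc r z = (1 / sqrt 2) *\<^sub>R vector [z\<^sup>2, (disc_aut r z)\<^sup>2]"

end

theory Submission
  imports Defs
begin

text \<open>The self-crossing of the disc \<open>f\<^sub>r = crossing_disc r\<close> couples the values of a multiplier near 1 to its
values near -1, and the way these are coupled determines r.

The involution \<open>\<sigma>\<^sub>r(x) = (r - x) / (1 - r x)\<close> of the disc satisfies \<open>f\<^sub>r(x) = (x\<^sup>2, \<sigma>\<^sub>r(x)\<^sup>2) / sqrt 2\<close>,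
so \<open>f\<^sub>r(\<sigma>\<^sub>r(x))\<close> is \<open>f\<^sub>r(x)\<close> with its two coordinates exchanged; it carries x near 1 to a point near -1.
For \<open>p, q \<in> [0,1)\<close> the kernel functions at \<open>(p,q) / sqrt 2\<close> and \<open>(q,p) / sqrt 2\<close> differ by a vector of
norm at most \<open>sqrt 2\<close>, although each of them blows up at the crossing point \<open>\<zeta> = (1,1) / sqrt 2\<close>. Hence
\<open>h(f\<^sub>r(x)) - h(f\<^sub>r(\<sigma>\<^sub>r(x)))\<close> is bounded for every h in the Drury-Arveson space
(\<open>swap_difference_bounded\<close>). Apply this to \<open>h = \<Psi> g\<close>, where \<open>\<Psi>\<close> is a multiplier and g is a function of
\<open>u = \<langle>z, \<zeta>\<rangle>\<close> alone, of size at least a constant times \<open>(1 - u) powr (-3/8)\<close>. As u is symmetric in the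
coordinates, g takes the same value at both points, and every \<open>\<phi> = \<Psi> \<circ> f\<^sub>r\<close> satisfies
\<open>\<phi>(x) - \<phi>(\<sigma>\<^sub>r(x)) = O((1 - x) powr (3/8))\<close> as x tends to 1 (\<open>crossing_multiplier_decay\<close>).

On the other hand \<open>(1 - u) powr (1/4)\<close> is a multiplier, because its Taylor series converges absolutely
at 1 and multiplication by u is a contraction. Its pullback by \<open>f\<^sub>s\<close> is of exact order
\<open>(1 - x) powr (1/4)\<close> both at x and at \<open>\<sigma>\<^sub>r(x)\<close>, with leading coefficients that agree only for \<open>r = s\<close>.
So for \<open>r \<noteq> s\<close> the difference is of exact order \<open>(1 - x) powr (1/4)\<close>, which the decay above excludes from
the algebra of \<open>f\<^sub>r\<close> (\<open>fourth_root_not_crossing_multiplier\<close>).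

Both facts about functions of u rest on one identity. Let \<open>y = (z\<^sub>1 - z\<^sub>2) / sqrt 2\<close> be the coordinate
orthogonal to u. Then \<open>K = 1 + u u* K + y y* K\<close> for the kernel K, so the Gram form loses at
least \<open>\<bar>\<Sum> c\<bar>\<^sup>2\<close> when its coefficients c are multiplied by the conjugate of u (\<open>gram_form_split\<close>); this is
iterated in \<open>gram_form_telescope\<close>. Such estimates on finite combinations of kernel functions decide
membership in the space by \<open>mem_iff_gram_bounded\<close>, which also shows that the function
space of a kernel is unique. Existence of the Drury-Arveson space comes from realizing its kernel by
square-summable families indexed by words, \<open>drury_arveson_rkhs_exists\<close>.\<close>

section \<open>Inner products of functions\<close>

context hilbert_function_space
begin

lemma diff_mem:
  assumes "g \<in> H" "h \<in> H"
  shows "(\<lambda>z\<in>X. g z - h z) \<in> H"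
proof -
  have "(\<lambda>z\<in>X. g z + (\<lambda>z\<in>X. (-1) * h z) z) \<in> H"
    by (intro add_mem scale_mem assms)
  also have "(\<lambda>z\<in>X. g z + (\<lambda>z\<in>X. (-1) * h z) z) = (\<lambda>z\<in>X. g z - h z)"
    by (auto simp: fun_eq_iff)
  finally show ?thesis .
qed

lemma lincomb_mem:
  assumes "g \<in> H" "h \<in> H"
  shows "(\<lambda>z\<in>X. g z + c * h z) \<in> H"
proof -
  have "(\<lambda>z\<in>X. g z + (\<lambda>z\<in>X. c * h z) z) \<in> H"
    by (intro add_mem scale_mem assms)
  also have "(\<lambda>z\<in>X. g z + (\<lambda>z\<in>X. c * h z) z) = (\<lambda>z\<in>X. g z + c * h z)"
    by (auto simp: fun_eq_iff)
  finally show ?thesis .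
qed

lemma ip_lincomb:
  assumes "g \<in> H" "h \<in> H" "u \<in> H"
  shows "ip (\<lambda>z\<in>X. g z + c * h z) u = ip g u + c * ip h u"
proof -
  have "ip (\<lambda>z\<in>X. g z + (\<lambda>z\<in>X. c * h z) z) u = ip g u + c * ip h u"
    using ip_add[OF assms(1) scale_mem[OF assms(2)] assms(3)] ip_scale[OF assms(2,3)] by metis
  also have "(\<lambda>z\<in>X. g z + (\<lambda>z\<in>X. c * h z) z) = (\<lambda>z\<in>X. g z + c * h z)"
    by (auto simp: fun_eq_iff)
  finally show ?thesis .
qed

lemma ip_lincomb_right:
  assumes "g \<in> H" "h \<in> H" "u \<in> H"
  shows "ip u (\<lambda>z\<in>X. g z + c * h z) = ip u g + cnj c * ip u h"
proof -
  have "ip u (\<lambda>z\<in>X. g z + c * h z) = cnj (ip (\<lambda>z\<in>X. g z + c * h z) u)"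
    by (rule ip_cnj) (use assms lincomb_mem in auto)
  also have "\<dots> = cnj (ip g u) + cnj c * cnj (ip h u)"
    using assms by (simp add: ip_lincomb)
  also have "cnj (ip g u) = ip u g" using assms ip_cnj[of g u] by simp
  also have "cnj (ip h u) = ip u h" using assms ip_cnj[of h u] by simp
  finally show ?thesis .
qed

lemma ip_diff:
  assumes "g \<in> H" "h \<in> H" "u \<in> H"
  shows "ip (\<lambda>z\<in>X. g z - h z) u = ip g u - ip h u"
  using ip_lincomb[OF assms, of "-1"] by simp

lemma ip_zero: "u \<in> H \<Longrightarrow> ip (\<lambda>z\<in>X. 0) u = 0"
  using ip_scale[of u u 0] by simp

text \<open>The expansion of the squared norm, from which Cauchy-Schwarz and all variational arguments below follow.\<close>

lemma norm_lincomb: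
  assumes "g \<in> H" "h \<in> H"
  shows "Re (ip (\<lambda>z\<in>X. g z + c * h z) (\<lambda>z\<in>X. g z + c * h z))
       = Re (ip g g) + 2 * Re (cnj c * ip g h) + (cmod c)\<^sup>2 * Re (ip h h)"
proof -
  have "ip (\<lambda>z\<in>X. g z + c * h z) (\<lambda>z\<in>X. g z + c * h z)
      = ip g g + cnj c * ip g h + c * ip h g + c * cnj c * ip h h"
    using assms by (simp add: ip_lincomb ip_lincomb_right lincomb_mem algebra_simps)
  moreover have "c * ip h g = cnj (cnj c * ip g h)"
    using ip_cnj[of g h] assms by simp
  moreover have "c * cnj c = of_real ((cmod c)\<^sup>2)"
    by (metis complex_norm_square)
  moreover have "Re (of_real ((cmod c)\<^sup>2) * ip h h) = (cmod c)\<^sup>2 * Re (ip h h)"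
    by (simp del: of_real_power)
  moreover have "Re (cnj (cnj c * ip g h)) = Re (cnj c * ip g h)"
    by (rule cnj.sel)
  ultimately show ?thesis by simp
qed

lemma cauchy_schwarz:
  assumes "g \<in> H" "h \<in> H"
  shows "(cmod (ip g h))\<^sup>2 \<le> Re (ip g g) * Re (ip h h)"
proof -
  have main: "0 \<le> Re (ip g g) - 2 * t * (cmod (ip g h))\<^sup>2 + t\<^sup>2 * (cmod (ip g h))\<^sup>2 * Re (ip h h)" for t
  proof -
    define c where "c = - of_real t * ip g h"
    have "Re (cnj c * ip g h) = - t * (cmod (ip g h))\<^sup>2"
      unfolding c_def cmod_power2 by (simp add: power2_eq_square algebra_simps)
    moreover have "(cmod c)\<^sup>2 = t\<^sup>2 * (cmod (ip g h))\<^sup>2"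
      unfolding c_def by (simp add: norm_mult power_mult_distrib)
    ultimately show ?thesis
      using norm_lincomb[OF assms, of c] ip_nonneg[OF lincomb_mem[OF assms, of c]] by simp
  qed
  show ?thesis
  proof (cases "Re (ip h h) = 0")
    case True
    have "(cmod (ip g h))\<^sup>2 = 0"
    proof (rule ccontr)
      assume n: "(cmod (ip g h))\<^sup>2 \<noteq> 0"
      have "0 \<le> Re (ip g g) - 2 * ((Re (ip g g) + 1) / (cmod (ip g h))\<^sup>2) * (cmod (ip g h))\<^sup>2"
        using main[of "(Re (ip g g) + 1) / (cmod (ip g h))\<^sup>2"] True by simp
      then have "0 \<le> Re (ip g g) - 2 * (Re (ip g g) + 1)" using n by simp
      then show False using ip_nonneg[OF assms(1)] by simp
    qed
    then show ?thesis using True by simp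
  next
    case False
    then have pos: "Re (ip h h) > 0" using ip_nonneg[OF assms(2)] by simp
    have "0 \<le> Re (ip g g) - (cmod (ip g h))\<^sup>2 / Re (ip h h)"
      using main[of "1 / Re (ip h h)"] pos by (simp add: power2_eq_square field_simps)
    then show ?thesis using pos by (simp add: field_simps)
  qed
qed

end

section \<open>The space of a reproducing kernel described by its Gram form\<close>

text \<open>The squared norm of the combination of the kernel functions at the points of S with coefficients c,
written without reference to a Hilbert space.\<close>

definition gram_form :: "('a \<Rightarrow> 'a \<Rightarrow> complex) \<Rightarrow> 'a set \<Rightarrow> ('a \<Rightarrow> complex) \<Rightarrow> complex" where
  "gram_form K S c = (\<Sum>w\<in>S. \<Sum>v\<in>S. c w * cnj (c v) * K w v)"

text \<open>Boundedness, with squared constant C, of the functional that f induces on combinations of kernel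
functions: if f lies in the space, this functional is the inner product with f.\<close>

definition gram_bounded :: "'a set \<Rightarrow> ('a \<Rightarrow> 'a \<Rightarrow> complex) \<Rightarrow> real \<Rightarrow> ('a \<Rightarrow> complex) \<Rightarrow> bool" where
  "gram_bounded X K C f \<longleftrightarrow> 0 \<le> C \<and> (\<forall>S c. finite S \<longrightarrow> S \<subseteq> X \<longrightarrow>
     (cmod (\<Sum>w\<in>S. cnj (c w) * f w))\<^sup>2 \<le> C * Re (gram_form K S c))"

context reproducing_kernel_hilbert_space
begin

definition comb :: "'a set \<Rightarrow> ('a \<Rightarrow> complex) \<Rightarrow> 'a \<Rightarrow> complex" where
  "comb S c = (\<lambda>z\<in>X. \<Sum>w\<in>S. c w * K w z)"

lemma comb_empty: "comb {} c = (\<lambda>z\<in>X. 0)"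
  by (simp add: comb_def)

lemma comb_insert:
  assumes "finite S" "w \<in> X" "w \<notin> S"
  shows "comb (insert w S) c = (\<lambda>z\<in>X. comb S c z + c w * restrict (K w) X z)"
  using assms by (auto simp: comb_def fun_eq_iff)

lemma comb_mem: "finite S \<Longrightarrow> S \<subseteq> X \<Longrightarrow> comb S c \<in> H"
proof (induction S rule: finite_induct)
  case empty
  show ?case unfolding comb_empty by (rule zero_mem)
next
  case (insert w S)
  then have "w \<in> X" "S \<subseteq> X" by auto
  then show ?case
    unfolding comb_insert[OF insert.hyps(1) \<open>w \<in> X\<close> insert.hyps(2)]
    by (intro lincomb_mem kernel_mem insert.IH)
qed

lemma ip_comb:
  assumes "finite S" "S \<subseteq> X" "g \<in> H"
  shows "ip g (comb S c) = (\<Sum>w\<in>S. cnj (c w) * g w)"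
  using assms
proof (induction S rule: finite_induct)
  case empty
  show ?case
    unfolding comb_empty using ip_cnj[OF zero_mem \<open>g \<in> H\<close>] ip_zero[OF \<open>g \<in> H\<close>]
    by (metis complex_cnj_cancel_iff complex_cnj_zero sum.empty)
next
  case (insert w S)
  then have w: "w \<in> X" and S: "S \<subseteq> X" by auto
  show ?case
    unfolding comb_insert[OF insert.hyps(1) w insert.hyps(2)]
      ip_lincomb_right[OF comb_mem[OF insert.hyps(1) S] kernel_mem[OF w] insert.prems(2)]
      reproducing[OF insert.prems(2) w, symmetric] insert.IH[OF S insert.prems(2)]
    using insert.hyps by simp
qed

lemma ip_comb_self:
  assumes "finite S" "S \<subseteq> X"
  shows "ip (comb S c) (comb S c) = gram_form K S c"
proof -
  have "ip (comb S c) (comb S c) = (\<Sum>v\<in>S. cnj (c v) * (\<Sum>w\<in>S. c w * K w v))"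
    using ip_comb[OF assms comb_mem[OF assms]] assms
    by (auto simp: comb_def intro!: sum.cong)
  also have "\<dots> = gram_form K S c"
    unfolding gram_form_def by (subst sum.swap) (simp add: sum_distrib_left mult_ac)
  finally show ?thesis .
qed

lemma gram_form_nonneg:
  assumes "finite S" "S \<subseteq> X" shows "0 \<le> Re (gram_form K S c)"
  using ip_nonneg[OF comb_mem[OF assms]] ip_comb_self[OF assms] by simp

lemma gram_bounded_if_mem:
  assumes "f \<in> H" shows "gram_bounded X K (Re (ip f f)) f"
  unfolding gram_bounded_def
proof (intro conjI allI impI)
  fix S c assume S: "finite S" "S \<subseteq> X"
  show "(cmod (\<Sum>w\<in>S. cnj (c w) * f w))\<^sup>2 \<le> Re (ip f f) * Re (gram_form K S c)"
    using cauchy_schwarz[OF assms comb_mem[OF S]] ip_comb[OF S assms] ip_comb_self[OF S] by simp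
qed (use assms ip_nonneg in auto)

text \<open>Combinations supported on S and on T are added on the union of the supports. The coefficients d do
not depend on f, so pairing with any f is additive in the same way, whether or not f
belongs to the space.\<close>

lemma comb_lincomb:
  assumes "finite S" "finite T" "S \<subseteq> X" "T \<subseteq> X"
  shows "\<exists>d. comb (S \<union> T) d = (\<lambda>z\<in>X. comb S c z + a * comb T e z) \<and>
    (\<forall>f :: 'a \<Rightarrow> complex. (\<Sum>w\<in>S \<union> T. cnj (d w) * f w)
        = (\<Sum>w\<in>S. cnj (c w) * f w) + cnj a * (\<Sum>w\<in>T. cnj (e w) * f w))"
proof (intro exI conjI allI)
  define d where "d w = (if w \<in> S then c w else 0) + a * (if w \<in> T then e w else 0)" for w
  have fin: "finite (S \<union> T)" using assms by simp
  have *: "(\<Sum>w\<in>S \<union> T. d w * F w) = (\<Sum>w\<in>S. c w * F w) + a * (\<Sum>w\<in>T. e w * F w)" for F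
  proof -
    have "(\<Sum>w\<in>S \<union> T. d w * F w)
       = (\<Sum>w\<in>S \<union> T. if w \<in> S then c w * F w else 0) + a * (\<Sum>w\<in>S \<union> T. if w \<in> T then e w * F w else 0)"
      unfolding sum_distrib_left sum.distrib[symmetric]
      by (rule sum.cong) (auto simp: d_def algebra_simps)
    also have "(\<Sum>w\<in>S \<union> T. if w \<in> S then c w * F w else 0) = (\<Sum>w\<in>S. c w * F w)"
      using fin by (subst sum.inter_restrict[symmetric]) (auto simp: Int_absorb1)
    also have "(\<Sum>w\<in>S \<union> T. if w \<in> T then e w * F w else 0) = (\<Sum>w\<in>T. e w * F w)"
      using fin by (subst sum.inter_restrict[symmetric]) (auto simp: Int_absorb1)
    finally show ?thesis .
  qed
  show "comb (S \<union> T) d = (\<lambda>z\<in>X. comb S c z + a * comb T e z)"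
    by (auto simp: comb_def fun_eq_iff *)
  show "(\<Sum>w\<in>S \<union> T. cnj (d w) * f w)
        = (\<Sum>w\<in>S. cnj (c w) * f w) + cnj a * (\<Sum>w\<in>T. cnj (e w) * f w)" for f :: "'a \<Rightarrow> complex"
    using arg_cong[OF *[of "\<lambda>w. cnj (f w)"], of cnj] by (simp add: mult.commute)
qed

lemma eval_le:
  assumes "g \<in> H" "w \<in> X"
  shows "(cmod (g w))\<^sup>2 \<le> Re (ip g g) * Re (K w w)"
proof -
  have "ip (restrict (K w) X) (restrict (K w) X) = K w w"
    using reproducing[OF kernel_mem[OF assms(2)] assms(2)] assms(2) by simp
  then show ?thesis
    using cauchy_schwarz[OF assms(1) kernel_mem[OF assms(2)]] reproducing[OF assms] by simp
qed

text \<open>This is Riesz representation for the functional L that f induces on the kernel combinations. The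
concave quantity \<open>J = 2 Re L - \<parallel>\<cdot>\<parallel>\<^sup>2\<close> is bounded by C, a maximizing sequence is Cauchy by the
parallelogram law, and varying it in the direction of a kernel function shows in the limit g that g = f.\<close>

lemma mem_if_gram_bounded:
  assumes ext: "f \<in> extensional X" and bd: "gram_bounded X K C f"
  shows "f \<in> H"
proof -
  define L where "L S c = (\<Sum>w\<in>S. cnj (c w) * f w)" for S c
  define Q where "Q u = Re (ip u u)" for u
  define J where "J S c = 2 * Re (L S c) - Q (comb S c)" for S c
  define A where "A = {J S c |S c. finite S \<and> S \<subseteq> X}"
  have C0: "0 \<le> C" using bd by (simp add: gram_bounded_def)
  have Lle: "(cmod (L S c))\<^sup>2 \<le> C * Q (comb S c)" if "finite S" "S \<subseteq> X" for S c
    using bd that ip_comb_self[OF that] unfolding gram_bounded_def L_def Q_def by simp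
  have JC: "J S c \<le> C" if S: "finite S" "S \<subseteq> X" for S c
  proof -
    have "Q (comb S c) \<ge> 0" unfolding Q_def using ip_nonneg comb_mem S by blast
    have "Re (L S c) \<le> cmod (L S c)" by (rule complex_Re_le_cmod)
    also have "\<dots> \<le> sqrt (C * Q (comb S c))" using Lle[OF S] by (rule real_le_rsqrt)
    also have "2 * \<dots> \<le> C + Q (comb S c)"
      using arith_geo_mean_sqrt[of C "Q (comb S c)"] C0 \<open>Q (comb S c) \<ge> 0\<close> by simp
    finally show ?thesis unfolding J_def by simp
  qed
  have bdd: "bdd_above A" unfolding A_def using JC by (intro bdd_aboveI[of _ C]) auto
  have ne: "A \<noteq> {}" unfolding A_def by blast
  define M where "M = Sup A"
  have JM: "J S c \<le> M" if "finite S" "S \<subseteq> X" for S c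
    unfolding M_def using that by (intro cSup_upper[OF _ bdd]) (auto simp: A_def)
  have "\<exists>S c. finite S \<and> S \<subseteq> X \<and> M - 1 / Suc n < J S c" for n
  proof -
    have "\<exists>x\<in>A. M - 1 / Suc n < x"
      unfolding M_def by (rule less_cSupD[OF ne]) simp
    then show ?thesis unfolding A_def by blast
  qed
  then obtain S c where Sc: "\<And>n. finite (S n)" "\<And>n. S n \<subseteq> X" "\<And>n. M - 1 / Suc n < J (S n) (c n)"
    by metis
  define u where "u n = comb (S n) (c n)" for n
  have uH: "u n \<in> H" for n unfolding u_def using Sc comb_mem by blast
  \<comment> \<open>Moving the n-th near-maximizer along any kernel combination cannot push J above its supremum.\<close>
  have vary: "J (S n) (c n) + 2 * Re (cnj a * L T e) - 2 * Re (cnj a * ip (u n) (comb T e))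
      - (cmod a)\<^sup>2 * Q (comb T e) \<le> M" if T: "finite T" "T \<subseteq> X" for n a T e
  proof -
    obtain d where d: "comb (S n \<union> T) d = (\<lambda>z\<in>X. comb (S n) (c n) z + a * comb T e z)"
      "\<And>f :: 'a \<Rightarrow> complex. (\<Sum>w\<in>S n \<union> T. cnj (d w) * f w)
        = (\<Sum>w\<in>S n. cnj (c n w) * f w) + cnj a * (\<Sum>w\<in>T. cnj (e w) * f w)"
      using comb_lincomb[OF Sc(1)[of n] T(1) Sc(2)[of n] T(2), of "c n" a e] by auto
    have "J (S n \<union> T) d \<le> M" using Sc T by (intro JM) auto
    moreover have "J (S n \<union> T) d = 2 * Re (L (S n) (c n)) + 2 * Re (cnj a * L T e)
        - (Q (u n) + 2 * Re (cnj a * ip (u n) (comb T e)) + (cmod a)\<^sup>2 * Q (comb T e))"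
      unfolding J_def d(1) L_def d(2) Q_def u_def
      by (subst norm_lincomb) (use Sc T comb_mem in \<open>auto\<close>)
    ultimately show ?thesis unfolding J_def u_def by simp
  qed
  \<comment> \<open>Comparing the midpoint of two near-maximizers with the supremum: the parallelogram law.\<close>
  have close: "Q (\<lambda>z\<in>X. u m z - u n z) \<le> 2 / Suc m + 2 / Suc n" for m n
  proof -
    obtain d where d: "comb (S n \<union> S m) d = (\<lambda>z\<in>X. comb (S n) (c n) z + 1 * comb (S m) (c m) z)"
      "\<And>f :: 'a \<Rightarrow> complex. (\<Sum>w\<in>S n \<union> S m. cnj (d w) * f w)
        = (\<Sum>w\<in>S n. cnj (c n w) * f w) + cnj 1 * (\<Sum>w\<in>S m. cnj (c m w) * f w)"
      using comb_lincomb[OF Sc(1)[of n] Sc(1)[of m] Sc(2)[of n] Sc(2)[of m], of "c n" 1 "c m"] by auto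
    obtain e where e: "comb ({} \<union> (S n \<union> S m)) e = (\<lambda>z\<in>X. comb {} d z + (1/2) * comb (S n \<union> S m) d z)"
      "\<And>f :: 'a \<Rightarrow> complex. (\<Sum>w\<in>{} \<union> (S n \<union> S m). cnj (e w) * f w)
        = (\<Sum>w\<in>{}. cnj (d w) * f w) + cnj (1/2) * (\<Sum>w\<in>S n \<union> S m. cnj (d w) * f w)"
      using comb_lincomb[of "{}" "S n \<union> S m" d "1/2" d] Sc by auto
    have Q0: "Q (\<lambda>z\<in>X. 0) = 0" unfolding Q_def using ip_zero[OF zero_mem] by simp
    have "J ({} \<union> (S n \<union> S m)) e \<le> M" using Sc by (intro JM) auto
    moreover have "Q (comb ({} \<union> (S n \<union> S m)) e) = 1/4 * Q (comb (S n \<union> S m) d)"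
    proof -
      have "Q (comb ({} \<union> (S n \<union> S m)) e) = Q (comb {} d) + 2 * Re (cnj (1/2) * ip (comb {} d) (comb (S n \<union> S m) d))
          + (cmod (1/2))\<^sup>2 * Q (comb (S n \<union> S m) d)"
        unfolding e(1) Q_def by (rule norm_lincomb) (use Sc in \<open>auto intro!: comb_mem\<close>)
      moreover have "ip (comb {} d) (comb (S n \<union> S m) d) = 0"
        unfolding comb_empty by (rule ip_zero) (use Sc in \<open>auto intro!: comb_mem\<close>)
      ultimately show ?thesis using Q0 by (simp add: comb_empty power2_eq_square)
    qed
    moreover have "Q (comb (S n \<union> S m) d) = Q (u n) + 2 * Re (ip (u n) (u m)) + Q (u m)"
      unfolding d(1) Q_def u_def by (subst norm_lincomb) (use Sc comb_mem in \<open>auto\<close>)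
    moreover have "Re (L ({} \<union> (S n \<union> S m)) e) = (Re (L (S n) (c n)) + Re (L (S m) (c m))) / 2"
      unfolding L_def e(2) d(2) by simp
    moreover have "Q (\<lambda>z\<in>X. u m z - u n z) = Q (u m) - 2 * Re (ip (u n) (u m)) + Q (u n)"
    proof -
      have "ip (u m) (u n) = cnj (ip (u n) (u m))" using ip_cnj uH by blast
      then show ?thesis
        using norm_lincomb[OF uH uH, of m "-1" n] unfolding Q_def by simp
    qed
    moreover have "2 * Ln - Qn + (2 * Lm - Qm) + Qd / 2 \<le> 2 * M"
      if "2 * Le - Qe \<le> M" "Qe = 1 / 4 * Qs" "Qs = Qn + 2 * I + Qm" "Le = (Ln + Lm) / 2"
        "Qd = Qm - 2 * I + Qn" for Le Qe Qs Qn I Qm Ln Lm Qd :: real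
    proof -
      have "4 * Qe = Qs" "2 * Le = Ln + Lm" using that by simp_all
      then have "4 * Ln - 2 * Qn + (4 * Lm - 2 * Qm) + Qd \<le> 4 * M" using that by linarith
      then show ?thesis by simp
    qed
    ultimately have "J (S n) (c n) + J (S m) (c m) + Q (\<lambda>z\<in>X. u m z - u n z) / 2 \<le> 2 * M"
      unfolding J_def u_def by presburger
    then show ?thesis using Sc(3)[of n] Sc(3)[of m] by simp
  qed
  have "\<exists>g\<in>H. (\<lambda>n. sqrt (Re (ip (\<lambda>z\<in>X. u n z - g z) (\<lambda>z\<in>X. u n z - g z)))) \<longlonglongrightarrow> 0"
  proof (rule complete)
    show "range u \<subseteq> H" using uH by auto
    show "\<forall>e>0. \<exists>N. \<forall>m\<ge>N. \<forall>n\<ge>N.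
        sqrt (Re (ip (\<lambda>z\<in>X. u m z - u n z) (\<lambda>z\<in>X. u m z - u n z))) < e"
    proof (intro allI impI)
      fix e :: real assume e: "e > 0"
      obtain N where N: "1 / real (Suc N) < e\<^sup>2 / 4"
        using nat_approx_posE[of "e\<^sup>2/4"] e by auto
      show "\<exists>N. \<forall>m\<ge>N. \<forall>n\<ge>N.
        sqrt (Re (ip (\<lambda>z\<in>X. u m z - u n z) (\<lambda>z\<in>X. u m z - u n z))) < e"
      proof (intro exI allI impI)
        fix m n assume mn: "N \<le> m" "N \<le> n"
        have "1 / real (Suc m) \<le> 1 / real (Suc N)" "1 / real (Suc n) \<le> 1 / real (Suc N)"
          using mn by (auto simp: frac_le)
        then have "Q (\<lambda>z\<in>X. u m z - u n z) < e\<^sup>2" using close[of m n] N by simp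
        then show "sqrt (Re (ip (\<lambda>z\<in>X. u m z - u n z) (\<lambda>z\<in>X. u m z - u n z))) < e"
          using e unfolding Q_def by (simp add: real_less_lsqrt)
      qed
    qed
  qed
  then obtain g where g: "g \<in> H" and
    lim: "(\<lambda>n. sqrt (Re (ip (\<lambda>z\<in>X. u n z - g z) (\<lambda>z\<in>X. u n z - g z)))) \<longlonglongrightarrow> 0" by blast
  have pt: "(\<lambda>n. u n w) \<longlonglongrightarrow> g w" if w: "w \<in> X" for w
  proof (rule Lim_null_comparison[THEN LIM_zero_cancel])
    show "(\<lambda>n. sqrt (Re (ip (\<lambda>z\<in>X. u n z - g z) (\<lambda>z\<in>X. u n z - g z))) * sqrt (Re (K w w))) \<longlonglongrightarrow> 0"
      using tendsto_mult_left_zero[OF lim] .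
    show "\<forall>\<^sub>F n in sequentially. norm (u n w - g w)
      \<le> sqrt (Re (ip (\<lambda>z\<in>X. u n z - g z) (\<lambda>z\<in>X. u n z - g z))) * sqrt (Re (K w w))"
    proof (intro always_eventually allI)
      fix n
      show "norm (u n w - g w)
      \<le> sqrt (Re (ip (\<lambda>z\<in>X. u n z - g z) (\<lambda>z\<in>X. u n z - g z))) * sqrt (Re (K w w))"
        using eval_le[OF diff_mem[OF uH[of n] g] w] w
        by (simp add: real_sqrt_mult[symmetric] real_le_rsqrt)
    qed
  qed
  have "f w = g w" if w: "w \<in> X" for w
  proof -
    define D where "D = f w - g w"
    have kw: "comb {w} (\<lambda>_. 1) = restrict (K w) X" by (auto simp: comb_def)
    define q where "q = Q (comb {w} (\<lambda>_. 1))"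
    have le: "2 * Re (cnj a * D) - (cmod a)\<^sup>2 * q \<le> 0" for a
    proof -
      have "M - 1 / real (Suc n) + 2 * Re (cnj a * f w) - 2 * Re (cnj a * u n w) - (cmod a)\<^sup>2 * q \<le> M" for n
      proof -
        have "ip (u n) (comb {w} (\<lambda>_. 1)) = u n w" unfolding kw using reproducing uH w by simp
        then show ?thesis using vary[of "{w}" n a "\<lambda>_. 1"] w Sc(3)[of n] by (simp add: L_def q_def)
      qed
      moreover have "(\<lambda>n. M - 1 / real (Suc n) + 2 * Re (cnj a * f w) - 2 * Re (cnj a * u n w) - (cmod a)\<^sup>2 * q)
          \<longlonglongrightarrow> M - 0 + 2 * Re (cnj a * f w) - 2 * Re (cnj a * g w) - (cmod a)\<^sup>2 * q"
        by (intro tendsto_intros pt w LIMSEQ_Suc[OF lim_1_over_n])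
      ultimately have "M - 0 + 2 * Re (cnj a * f w) - 2 * Re (cnj a * g w) - (cmod a)\<^sup>2 * q \<le> M"
        by (intro LIMSEQ_le_const2) auto
      then show ?thesis unfolding D_def by (simp add: algebra_simps)
    qed
    \<comment> \<open>For a = t D the linear term is of order t and the quadratic one of order \<open>t\<^sup>2\<close>, so small t forces D = 0.\<close>
    have le2: "2 * t * (cmod D)\<^sup>2 \<le> t\<^sup>2 * (cmod D)\<^sup>2 * q" for t
    proof -
      have "Re (cnj (of_real t * D) * D) = t * (cmod D)\<^sup>2"
        unfolding cmod_power2 by (simp add: power2_eq_square algebra_simps)
      then show ?thesis using le[of "of_real t * D"] by (simp add: norm_mult power_mult_distrib)
    qed
    have "D = 0"
    proof (rule ccontr)
      assume "D \<noteq> 0"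
      then have 1: "2 * t \<le> t\<^sup>2 * q" for t
        using le2[of t] mult_le_cancel_right[of "2 * t" "(cmod D)\<^sup>2" "t\<^sup>2 * q"] by (simp add: mult_ac)
      have "q \<ge> 0" unfolding q_def Q_def using w by (intro ip_nonneg comb_mem) auto
      define t where "t = 1 / (q + 1)"
      have t: "t > 0" "t * q \<le> 1" using \<open>q \<ge> 0\<close> by (auto simp: t_def)
      have "t * 2 \<le> t * (t * q)" using 1[of t] by (simp add: power2_eq_square mult_ac)
      then show False using t by simp
    qed
    then show ?thesis by (simp add: D_def)
  qed
  then have "f = g" using ext functions_on g by (intro extensionalityI[of f X g]) auto
  then show ?thesis using g by simp
qed

text \<open>The right-hand side mentions only the set X and the kernel K, hence uniqueness of the space.\<close>

lemma mem_iff_gram_bounded: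
  "H = {f \<in> extensional X. \<exists>C. gram_bounded X K C f}"
  using functions_on gram_bounded_if_mem mem_if_gram_bounded by blast

end

lemma rkhs_eq_gram_bounded:
  assumes "reproducing_kernel_hilbert_space X K H ip"
  shows "rkhs X K = {f \<in> extensional X. \<exists>C. gram_bounded X K C f}"
  unfolding rkhs_def
  using assms by (blast intro!: the_equality dest: reproducing_kernel_hilbert_space.mem_iff_gram_bounded)

section \<open>Kernels with a feature map\<close>

context hilbert_function_space
begin

text \<open>Every a in H defines a function \<open>z \<mapsto> ip a (e z)\<close> on Y. On the orthogonal complement A of the null
vectors N this assignment T is injective, so the inner product can be transported along it. All feature vectors
lie in A, and A is closed, which gives completeness.\<close>

lemma rkhs_of_feature_map:
  fixes Y :: "'b set" and e :: "'b \<Rightarrow> 'a \<Rightarrow> complex"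
  assumes e: "\<And>w. w \<in> Y \<Longrightarrow> e w \<in> H"
    and K: "\<And>w z. w \<in> Y \<Longrightarrow> z \<in> Y \<Longrightarrow> K w z = ip (e w) (e z)"
  shows "\<exists>F ipF. reproducing_kernel_hilbert_space Y K F ipF"
proof -
  \<comment> \<open>N consists of the vectors that induce the zero function, A is its orthogonal complement.\<close>
  define N where "N = {b \<in> H. \<forall>z\<in>Y. ip b (e z) = 0}"
  define A where "A = {a \<in> H. \<forall>b\<in>N. ip a b = 0}"
  define T where "T a = (\<lambda>z\<in>Y. ip a (e z))" for a
  define S where "S = the_inv_into A T"
  have AH: "A \<subseteq> H" by (auto simp: A_def)
  have NH: "N \<subseteq> H" by (auto simp: N_def)
  have T_lin: "T (\<lambda>z\<in>X. a z + c * b z) = (\<lambda>z\<in>Y. T a z + c * T b z)" if "a \<in> A" "b \<in> A" for a b c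
    using that AH e by (auto simp: T_def fun_eq_iff ip_lincomb subset_iff)
  have A_lin: "(\<lambda>z\<in>X. a z + c * b z) \<in> A" if "a \<in> A" "b \<in> A" for a b c
    using that NH by (auto simp: A_def ip_lincomb lincomb_mem subset_iff)
  have A_zero: "(\<lambda>z\<in>X. 0) \<in> A" using NH by (auto simp: A_def ip_zero zero_mem subset_iff)
  have T_zero: "T (\<lambda>z\<in>X. 0) = (\<lambda>z\<in>Y. 0)" using e by (auto simp: T_def ip_zero fun_eq_iff)
  have A_scale: "(\<lambda>z\<in>X. c * a z) \<in> A" if "a \<in> A" for a c
    using that NH by (auto simp: A_def ip_scale scale_mem subset_iff)
  have T_scale: "T (\<lambda>z\<in>X. c * a z) = (\<lambda>z\<in>Y. c * T a z)" if "a \<in> A" for a c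
    using that AH e by (auto simp: T_def fun_eq_iff ip_scale subset_iff)
  have inj: "inj_on T A"
  proof (rule inj_onI)
    fix a b assume ab: "a \<in> A" "b \<in> A" "T a = T b"
    define d where "d = (\<lambda>z\<in>X. a z - b z)"
    have dA: "d \<in> A" using A_lin[OF ab(1,2), of "-1"] by (simp add: d_def)
    have "ip d (e z) = 0" if "z \<in> Y" for z
      using fun_cong[OF ab(3), of z] that ab AH e unfolding d_def
      by (subst ip_diff) (auto simp: T_def)
    then have "d \<in> N" using dA AH by (auto simp: N_def)
    then have "ip d d = 0" using dA by (auto simp: A_def)
    then have "d = (\<lambda>z\<in>X. 0)" using ip_definite dA AH by blast
    then have "a z = b z" if "z \<in> X" for z
      using that unfolding d_def by (auto dest: fun_cong[of _ _ z])
    moreover have "a \<in> extensional X" "b \<in> extensional X" using ab AH functions_on by auto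
    ultimately show "a = b" by (intro extensionalityI)
  qed
  have ST: "S (T a) = a" if "a \<in> A" for a unfolding S_def using the_inv_into_f_f[OF inj that] .
  have kerA: "e w \<in> A" if "w \<in> Y" for w
  proof -
    have "ip (e w) b = 0" if b: "b \<in> N" for b
      using ip_cnj[of b "e w"] b \<open>w \<in> Y\<close> e NH by (auto simp: N_def)
    then show ?thesis using e that by (auto simp: A_def)
  qed
  have Tker: "restrict (K w) Y = T (e w)" if "w \<in> Y" for w
    using that by (auto simp: T_def K fun_eq_iff)
  have "reproducing_kernel_hilbert_space Y K (T ` A) (\<lambda>f g. ip (S f) (S g))"
  proof unfold_locales
    show "T ` A \<subseteq> extensional Y" by (auto simp: T_def)
    show "(\<lambda>z\<in>Y. 0) \<in> T ` A" using T_zero A_zero by (metis imageI)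
  next
    fix g h assume "g \<in> T ` A" "h \<in> T ` A"
    then obtain a b where ab: "a \<in> A" "b \<in> A" "g = T a" "h = T b" by blast
    have eq: "(\<lambda>z\<in>Y. g z + h z) = T (\<lambda>z\<in>X. a z + 1 * b z)"
      unfolding T_lin[OF ab(1,2)] ab by simp
    show "(\<lambda>z\<in>Y. g z + h z) \<in> T ` A" unfolding eq using A_lin[OF ab(1,2)] by blast
    fix u assume "u \<in> T ` A"
    then obtain x where x: "x \<in> A" "u = T x" by blast
    show "ip (S (\<lambda>z\<in>Y. g z + h z)) (S u) = ip (S g) (S u) + ip (S h) (S u)"
      unfolding eq ST[OF A_lin[OF ab(1,2)]] unfolding ab x ST[OF ab(1)] ST[OF ab(2)] ST[OF x(1)]
      using ab x AH by (subst ip_lincomb) auto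
  next
    fix c g assume "g \<in> T ` A"
    then obtain a where a: "a \<in> A" "g = T a" by blast
    have eq: "(\<lambda>z\<in>Y. c * g z) = T (\<lambda>z\<in>X. c * a z)"
      unfolding T_scale[OF a(1)] a by simp
    show "(\<lambda>z\<in>Y. c * g z) \<in> T ` A" unfolding eq using A_scale[OF a(1)] by blast
    fix u assume "u \<in> T ` A"
    then obtain x where x: "x \<in> A" "u = T x" by blast
    show "ip (S (\<lambda>z\<in>Y. c * g z)) (S u) = c * ip (S g) (S u)"
      unfolding eq ST[OF A_scale[OF a(1)]] unfolding a x ST[OF a(1)] ST[OF x(1)]
      using a x AH by (subst ip_scale) auto
  next
    fix g u assume "g \<in> T ` A" "u \<in> T ` A"
    then obtain a b where ab: "a \<in> A" "b \<in> A" "g = T a" "u = T b" by blast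
    show "ip (S u) (S g) = cnj (ip (S g) (S u))"
      unfolding ab ST[OF ab(1)] ST[OF ab(2)] using ab AH ip_cnj by blast
  next
    fix g assume "g \<in> T ` A"
    then obtain a where a: "a \<in> A" "g = T a" by blast
    show "0 \<le> Re (ip (S g) (S g))" unfolding a ST[OF a(1)] using a AH ip_nonneg by blast
    assume "ip (S g) (S g) = 0"
    then have "a = (\<lambda>z\<in>X. 0)" unfolding a ST[OF a(1)] using a AH ip_definite by blast
    then show "g = (\<lambda>z\<in>Y. 0)" unfolding a using T_zero by simp
  next
    fix G :: "nat \<Rightarrow> 'b \<Rightarrow> complex"
    assume "range G \<subseteq> T ` A"
      and cauchy: "\<forall>e>0. \<exists>N. \<forall>m\<ge>N. \<forall>n\<ge>N.
        sqrt (Re (ip (S (\<lambda>z\<in>Y. G m z - G n z)) (S (\<lambda>z\<in>Y. G m z - G n z)))) < e"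
    then have "\<forall>n. \<exists>a\<in>A. G n = T a" by blast
    then obtain a where a: "\<And>n. a n \<in> A" "\<And>n. G n = T (a n)" by metis
    have diff: "S (\<lambda>z\<in>Y. T b z - T c z) = (\<lambda>z\<in>X. b z - c z)" if "b \<in> A" "c \<in> A" for b c
      using ST[OF A_lin[OF that, of "-1"]] unfolding T_lin[OF that] by simp
    have "\<exists>g\<in>H. (\<lambda>n. sqrt (Re (ip (\<lambda>z\<in>X. a n z - g z) (\<lambda>z\<in>X. a n z - g z)))) \<longlonglongrightarrow> 0"
    proof (rule complete)
      show "range a \<subseteq> H" using a AH by auto
      show "\<forall>e>0. \<exists>N. \<forall>m\<ge>N. \<forall>n\<ge>N.
        sqrt (Re (ip (\<lambda>z\<in>X. a m z - a n z) (\<lambda>z\<in>X. a m z - a n z))) < e"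
        using cauchy unfolding a(2) diff[OF a(1) a(1)] .
    qed
    then obtain g where g: "g \<in> H"
      and lim: "(\<lambda>n. sqrt (Re (ip (\<lambda>z\<in>X. a n z - g z) (\<lambda>z\<in>X. a n z - g z)))) \<longlonglongrightarrow> 0" by blast
    have "ip g b = 0" if b: "b \<in> N" for b
    proof -
      have bH: "b \<in> H" using b NH by blast
      have "(\<lambda>n. ip (a n) b - ip g b) \<longlonglongrightarrow> 0"
      proof (rule Lim_null_comparison)
        show "(\<lambda>n. sqrt (Re (ip (\<lambda>z\<in>X. a n z - g z) (\<lambda>z\<in>X. a n z - g z))) * sqrt (Re (ip b b))) \<longlonglongrightarrow> 0"
          using tendsto_mult_left_zero[OF lim] .
        show "\<forall>\<^sub>F n in sequentially. norm (ip (a n) b - ip g b)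
          \<le> sqrt (Re (ip (\<lambda>z\<in>X. a n z - g z) (\<lambda>z\<in>X. a n z - g z))) * sqrt (Re (ip b b))"
        proof (intro always_eventually allI)
          fix n
          have an: "a n \<in> H" using a AH by blast
          show "norm (ip (a n) b - ip g b)
            \<le> sqrt (Re (ip (\<lambda>z\<in>X. a n z - g z) (\<lambda>z\<in>X. a n z - g z))) * sqrt (Re (ip b b))"
            using cauchy_schwarz[OF diff_mem[OF an g] bH] unfolding ip_diff[OF an g bH]
            by (simp add: real_sqrt_mult[symmetric] real_le_rsqrt)
        qed
      qed
      moreover have "ip (a n) b = 0" for n using a b by (auto simp: A_def)
      ultimately have "(\<lambda>n::nat. - ip g b) \<longlonglongrightarrow> 0" by simp
      then show ?thesis using LIMSEQ_unique[OF tendsto_const] by fastforce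
    qed
    then have gA: "g \<in> A" using g by (simp add: A_def)
    show "\<exists>g\<in>T ` A. (\<lambda>n. sqrt (Re (ip (S (\<lambda>z\<in>Y. G n z - g z)) (S (\<lambda>z\<in>Y. G n z - g z))))) \<longlonglongrightarrow> 0"
      by (rule bexI[of _ "T g"]) (use lim gA in \<open>simp_all only: a(2) diff[OF a(1) gA] imageI\<close>)
  next
    fix w assume w: "w \<in> Y"
    show "restrict (K w) Y \<in> T ` A" unfolding Tker[OF w] using kerA[OF w] by blast
    fix g assume "g \<in> T ` A"
    then obtain a where a: "a \<in> A" "g = T a" by blast
    show "g w = ip (S g) (S (restrict (K w) Y))"
      unfolding Tker[OF w] ST[OF kerA[OF w]] unfolding a ST[OF a(1)] using w by (simp add: T_def)
  qed
  then show ?thesis by blast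
qed

end

section \<open>Square-summable families\<close>

definition square_summable :: "('i \<Rightarrow> complex) set" where
  "square_summable = {a. (\<lambda>i. (cmod (a i))\<^sup>2) summable_on UNIV}"

lemma square_summable_product:
  assumes "a \<in> square_summable" "b \<in> square_summable"
  shows "(\<lambda>i. a i * cnj (b i)) summable_on UNIV"
proof -
  have "(\<lambda>i. (cmod (a i))\<^sup>2 + (cmod (b i))\<^sup>2) summable_on UNIV"
    using assms by (intro summable_on_add) (auto simp: square_summable_def)
  then have "(\<lambda>i. norm (a i * cnj (b i))) summable_on UNIV"
  proof (rule Infinite_Sum.abs_summable_on_comparison_test')
    fix i
    have "2 * (cmod (a i) * cmod (b i)) \<le> (cmod (a i))\<^sup>2 + (cmod (b i))\<^sup>2"
      using sum_squares_bound[of "cmod (a i)" "cmod (b i)"] by (simp add: mult.assoc)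
    moreover have "0 \<le> cmod (a i) * cmod (b i)" by simp
    ultimately show "norm (a i * cnj (b i)) \<le> (cmod (a i))\<^sup>2 + (cmod (b i))\<^sup>2"
      by (simp add: norm_mult del: mult_nonneg_nonneg)
  qed
  then show ?thesis by (rule abs_summable_summable)
qed

lemma square_summable_add:
  assumes "a \<in> square_summable" "b \<in> square_summable"
  shows "(\<lambda>i. a i + b i) \<in> square_summable"
proof -
  have "(\<lambda>i. 2 * (cmod (a i))\<^sup>2 + 2 * (cmod (b i))\<^sup>2) summable_on UNIV"
    using assms by (intro summable_on_add summable_on_cmult_right) (auto simp: square_summable_def)
  then have "(\<lambda>i. (cmod (a i + b i))\<^sup>2) summable_on UNIV"
  proof (rule summable_on_comparison_test)
    fix i
    have "(cmod (a i + b i))\<^sup>2 \<le> (cmod (a i) + cmod (b i))\<^sup>2"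
      by (intro power_mono norm_triangle_ineq) simp
    also have "\<dots> \<le> 2 * (cmod (a i))\<^sup>2 + 2 * (cmod (b i))\<^sup>2"
      using sum_squares_bound[of "cmod (a i)" "cmod (b i)"] by (simp add: power2_sum)
    finally show "(cmod (a i + b i))\<^sup>2 \<le> 2 * (cmod (a i))\<^sup>2 + 2 * (cmod (b i))\<^sup>2" .
  qed simp
  then show ?thesis by (simp add: square_summable_def)
qed

lemma square_summable_scale:
  assumes "a \<in> square_summable"
  shows "(\<lambda>i. c * a i) \<in> square_summable"
  using assms unfolding square_summable_def
  by (simp add: norm_mult power_mult_distrib summable_on_cmult_right)

lemma square_summable_diff:
  assumes "a \<in> square_summable" "b \<in> square_summable"
  shows "(\<lambda>i. a i - b i) \<in> square_summable"
  using square_summable_add[OF assms(1) square_summable_scale[OF assms(2), of "-1"]] by simp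

lemma square_summable_norm:
  assumes "a \<in> square_summable"
  shows "(\<Sum>\<^sub>\<infinity>i. a i * cnj (a i)) = of_real (\<Sum>\<^sub>\<infinity>i. (cmod (a i))\<^sup>2)"
proof (rule infsumI)
  have "((\<lambda>i. complex_of_real ((cmod (a i))\<^sup>2)) has_sum of_real (\<Sum>\<^sub>\<infinity>i. (cmod (a i))\<^sup>2)) UNIV"
    unfolding has_sum_of_real_iff
    by (rule has_sum_infsum) (use assms in \<open>simp add: square_summable_def\<close>)
  then show "((\<lambda>i. a i * cnj (a i)) has_sum of_real (\<Sum>\<^sub>\<infinity>i. (cmod (a i))\<^sup>2)) UNIV"
    unfolding complex_norm_square .
qed

text \<open>The pointwise limit is the limit in norm: the Cauchy estimate passes to the limit on every finite
set of indices.\<close>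

lemma square_summable_complete:
  fixes G :: "nat \<Rightarrow> 'i \<Rightarrow> complex"
  assumes G: "\<And>n. G n \<in> square_summable"
    and cauchy: "\<And>e. e > 0 \<Longrightarrow> \<exists>N. \<forall>m\<ge>N. \<forall>n\<ge>N. (\<Sum>\<^sub>\<infinity>i. (cmod (G m i - G n i))\<^sup>2) < e"
  shows "\<exists>g\<in>square_summable. (\<lambda>n. \<Sum>\<^sub>\<infinity>i. (cmod (G n i - g i))\<^sup>2) \<longlonglongrightarrow> 0"
proof -
  define g where "g i = lim (\<lambda>n. G n i)" for i
  have summ: "(\<lambda>i. (cmod (G m i - G n i))\<^sup>2) summable_on UNIV" for m n
    using square_summable_diff[OF G G] by (simp add: square_summable_def)
  have fin: "(\<Sum>i\<in>F. (cmod (G m i - G n i))\<^sup>2) \<le> (\<Sum>\<^sub>\<infinity>i. (cmod (G m i - G n i))\<^sup>2)" if "finite F" for F m n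
    using that by (intro finite_sum_le_infsum summ) auto
  have "Cauchy (\<lambda>n. G n i)" for i
  proof (rule metric_CauchyI)
    fix e :: real assume e: "e > 0"
    obtain N where N: "\<forall>m\<ge>N. \<forall>n\<ge>N. (\<Sum>\<^sub>\<infinity>i. (cmod (G m i - G n i))\<^sup>2) < e\<^sup>2"
      using cauchy[of "e\<^sup>2"] e by auto
    have "dist (G m i) (G n i) < e" if "m \<ge> N" "n \<ge> N" for m n
    proof -
      have "(cmod (G m i - G n i))\<^sup>2 < e\<^sup>2" using fin[of "{i}" m n] N that by force
      then show ?thesis using e by (simp add: dist_norm power2_less_imp_less)
    qed
    then show "\<exists>M. \<forall>m\<ge>M. \<forall>n\<ge>M. dist (G m i) (G n i) < e" by blast
  qed
  then have g: "(\<lambda>n. G n i) \<longlonglongrightarrow> g i" for i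
    unfolding g_def by (simp add: Cauchy_convergent flip: convergent_LIMSEQ_iff)
  have bound: "(\<lambda>i. (cmod (G m i - g i))\<^sup>2) summable_on UNIV \<and> (\<Sum>\<^sub>\<infinity>i. (cmod (G m i - g i))\<^sup>2) \<le> e"
    if N: "\<forall>m\<ge>N. \<forall>n\<ge>N. (\<Sum>\<^sub>\<infinity>i. (cmod (G m i - G n i))\<^sup>2) < e" and m: "m \<ge> N" for N e m
  proof -
    have le: "(\<Sum>i\<in>F. (cmod (G m i - g i))\<^sup>2) \<le> e" if F: "finite F" for F
    proof (rule LIMSEQ_le_const2)
      show "(\<lambda>n. \<Sum>i\<in>F. (cmod (G m i - G n i))\<^sup>2) \<longlonglongrightarrow> (\<Sum>i\<in>F. (cmod (G m i - g i))\<^sup>2)"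
        by (intro tendsto_intros g)
      show "\<exists>k. \<forall>n\<ge>k. (\<Sum>i\<in>F. (cmod (G m i - G n i))\<^sup>2) \<le> e"
        using N m fin[OF F, of m] by (meson less_imp_le order.trans)
    qed
    have "(\<lambda>i. (cmod (G m i - g i))\<^sup>2) summable_on UNIV"
      by (rule nonneg_bdd_above_summable_on) (auto intro!: bdd_aboveI[of _ e] le)
    then show ?thesis using le by (auto intro!: infsum_le_finite_sums)
  qed
  obtain N where N: "\<forall>m\<ge>N. \<forall>n\<ge>N. (\<Sum>\<^sub>\<infinity>i. (cmod (G m i - G n i))\<^sup>2) < 1" using cauchy[of 1] by auto
  have "(\<lambda>i. G N i - g i) \<in> square_summable" using bound[OF N] by (auto simp: square_summable_def)
  from square_summable_diff[OF G[of N] this] have "g \<in> square_summable" by simp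
  moreover have "(\<lambda>n. \<Sum>\<^sub>\<infinity>i. (cmod (G n i - g i))\<^sup>2) \<longlonglongrightarrow> 0"
  proof (rule LIMSEQ_I)
    fix e :: real assume e: "e > 0"
    obtain N where N: "\<forall>m\<ge>N. \<forall>n\<ge>N. (\<Sum>\<^sub>\<infinity>i. (cmod (G m i - G n i))\<^sup>2) < e / 2"
      using cauchy[of "e/2"] e by auto
    have "norm ((\<Sum>\<^sub>\<infinity>i. (cmod (G n i - g i))\<^sup>2) - 0) < e" if "n \<ge> N" for n
      using bound[OF N that] e by (simp add: abs_of_nonneg infsum_nonneg)
    then show "\<exists>no. \<forall>n\<ge>no. norm ((\<Sum>\<^sub>\<infinity>i. (cmod (G n i - g i))\<^sup>2) - 0) < e" by blast
  qed
  ultimately show ?thesis by blast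
qed

lemma square_summable_hilbert:
  "hilbert_function_space UNIV (square_summable :: ('i \<Rightarrow> complex) set) (\<lambda>a b. \<Sum>\<^sub>\<infinity>i. a i * cnj (b i))"
proof (unfold_locales; (unfold restrict_UNIV)?)
  show "square_summable \<subseteq> extensional UNIV" by (auto simp: extensional_def)
  show "(\<lambda>z. 0) \<in> square_summable" by (simp add: square_summable_def)
  fix a b c :: "'i \<Rightarrow> complex"
  assume a: "a \<in> square_summable"
  show "(\<lambda>z. k * a z) \<in> square_summable" for k by (rule square_summable_scale[OF a])
  show "0 \<le> Re (\<Sum>\<^sub>\<infinity>i. a i * cnj (a i))" by (simp add: square_summable_norm[OF a] infsum_nonneg)
  show "a = (\<lambda>z. 0)" if "(\<Sum>\<^sub>\<infinity>i. a i * cnj (a i)) = 0"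
  proof
    fix i
    have "(\<Sum>\<^sub>\<infinity>i. (cmod (a i))\<^sup>2) = 0" using that by (simp add: square_summable_norm[OF a])
    moreover have "(\<Sum>i\<in>{i}. (cmod (a i))\<^sup>2) \<le> (\<Sum>\<^sub>\<infinity>i. (cmod (a i))\<^sup>2)"
      using a by (intro finite_sum_le_infsum) (auto simp: square_summable_def)
    ultimately show "a i = 0" by simp
  qed
  assume b: "b \<in> square_summable"
  show "(\<lambda>z. a z + b z) \<in> square_summable" by (rule square_summable_add[OF a b])
  show "(\<Sum>\<^sub>\<infinity>i. b i * cnj (a i)) = cnj (\<Sum>\<^sub>\<infinity>i. a i * cnj (b i))"
    by (simp add: mult.commute flip: infsum_cnj)
  show "(\<Sum>\<^sub>\<infinity>i. k * a i * cnj (b i)) = k * (\<Sum>\<^sub>\<infinity>i. a i * cnj (b i))" for k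
    using infsum_cmult_right[OF square_summable_product[OF a b], of k] by (simp add: mult.assoc)
  assume c: "c \<in> square_summable"
  show "(\<Sum>\<^sub>\<infinity>i. (a i + b i) * cnj (c i)) = (\<Sum>\<^sub>\<infinity>i. a i * cnj (c i)) + (\<Sum>\<^sub>\<infinity>i. b i * cnj (c i))"
    using infsum_add[OF square_summable_product[OF a c] square_summable_product[OF b c]]
    by (simp add: algebra_simps)
next
  fix G :: "nat \<Rightarrow> 'i \<Rightarrow> complex"
  assume G: "range G \<subseteq> square_summable"
    and cauchy: "\<forall>e>0. \<exists>N. \<forall>m\<ge>N. \<forall>n\<ge>N.
      sqrt (Re (\<Sum>\<^sub>\<infinity>i. (G m i - G n i) * cnj (G m i - G n i))) < e"
  have GS: "G n \<in> square_summable" for n using G by auto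
  have "\<exists>g\<in>square_summable. (\<lambda>n. \<Sum>\<^sub>\<infinity>i. (cmod (G n i - g i))\<^sup>2) \<longlonglongrightarrow> 0"
  proof (rule square_summable_complete)
    fix e :: real assume "e > 0"
    then show "\<exists>N. \<forall>m\<ge>N. \<forall>n\<ge>N. (\<Sum>\<^sub>\<infinity>i. (cmod (G m i - G n i))\<^sup>2) < e"
      using cauchy[rule_format, of "sqrt e"]
      unfolding square_summable_norm[OF square_summable_diff[OF GS GS]] by simp
  qed (rule GS)
  then obtain g where g: "g \<in> square_summable"
    "(\<lambda>n. \<Sum>\<^sub>\<infinity>i. (cmod (G n i - g i))\<^sup>2) \<longlonglongrightarrow> 0" by blast
  have "(\<lambda>n. sqrt (Re (\<Sum>\<^sub>\<infinity>i. (G n i - g i) * cnj (G n i - g i)))) \<longlonglongrightarrow> 0"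
    using tendsto_real_sqrt[OF g(2)]
    unfolding square_summable_norm[OF square_summable_diff[OF GS g(1)]] by simp
  then show "\<exists>g\<in>square_summable. (\<lambda>n. sqrt (Re (\<Sum>\<^sub>\<infinity>i. (G n i - g i) * cnj (G n i - g i)))) \<longlonglongrightarrow> 0"
    using g by blast
qed

section \<open>The Drury-Arveson space as a space of words\<close>

text \<open>The noncommutative multinomial expansion, in which every word occurs with coefficient 1.\<close>

lemma sum_words_of_length:
  fixes x :: "'d::finite \<Rightarrow> 'a::comm_semiring_1"
  shows "(\<Sum>\<alpha> | length \<alpha> = n. prod_list (map x \<alpha>)) = (\<Sum>j\<in>UNIV. x j) ^ n"
proof (induction n)
  case (Suc n)
  have "bij_betw (\<lambda>(j, \<alpha>). j # \<alpha>) (UNIV \<times> {\<alpha>. length \<alpha> = n}) {\<alpha> :: 'd list. length \<alpha> = Suc n}"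
    by (rule bij_betwI[where g = "\<lambda>\<alpha>. (hd \<alpha>, tl \<alpha>)"]) (auto simp: length_Suc_conv)
  then have "(\<Sum>\<alpha> | length \<alpha> = Suc n. prod_list (map x \<alpha>))
      = (\<Sum>(j, \<alpha>)\<in>UNIV \<times> {\<alpha>. length \<alpha> = n}. x j * prod_list (map x \<alpha>))"
    by (subst sum.reindex_bij_betw[symmetric]) (auto intro!: sum.cong)
  also have "\<dots> = (\<Sum>j\<in>UNIV. x j) * (\<Sum>\<alpha> | length \<alpha> = n. prod_list (map x \<alpha>))"
    by (simp add: sum_product sum.cartesian_product)
  finally show ?case using Suc by simp
qed simp

lemma finite_words: "finite {\<alpha> :: 'd::finite list. length \<alpha> < N}"
  by (rule finite_subset[OF _ finite_lists_length_le[of "UNIV :: 'd set" N]]) auto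

lemma sum_words_shorter_than:
  fixes x :: "'d::finite \<Rightarrow> 'a::comm_semiring_1"
  shows "(\<Sum>\<alpha> | length \<alpha> < N. prod_list (map x \<alpha>)) = (\<Sum>n<N. (\<Sum>j\<in>UNIV. x j) ^ n)"
proof -
  have fin: "finite {\<alpha> :: 'd list. length \<alpha> = n}" for n
    by (rule finite_subset[OF _ finite_words[of "Suc n"]]) auto
  have "{\<alpha> :: 'd list. length \<alpha> < N} = (\<Union>n<N. {\<alpha>. length \<alpha> = n})" by auto
  then have "(\<Sum>\<alpha> | length \<alpha> < N. prod_list (map x \<alpha>)) = (\<Sum>n<N. \<Sum>\<alpha> | length \<alpha> = n. prod_list (map x \<alpha>))"
    by (simp only:) (rule sum.UNION_disjoint, use fin in auto)
  then show ?thesis by (simp add: sum_words_of_length)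
qed

lemma norm_prod_list: "norm (prod_list xs) = prod_list (map norm xs)"
  for xs :: "'a::real_normed_div_algebra list"
  by (induction xs) (auto simp: norm_mult)

lemma has_sum_words:
  fixes x :: "'d::finite \<Rightarrow> complex"
  assumes "(\<Sum>j\<in>UNIV. norm (x j)) < 1"
  shows "((\<lambda>\<alpha>. prod_list (map x \<alpha>)) has_sum 1 / (1 - (\<Sum>j\<in>UNIV. x j))) UNIV"
proof -
  define s where "s = (\<Sum>j\<in>UNIV. norm (x j))"
  have s: "0 \<le> s" "s < 1" using assms by (auto simp: s_def sum_nonneg)
  have norm_eq: "norm (prod_list (map x \<alpha>)) = prod_list (map (\<lambda>j. norm (x j)) \<alpha>)" for \<alpha>
    by (simp add: norm_prod_list o_def)
  have le: "(\<Sum>\<alpha>\<in>F. norm (prod_list (map x \<alpha>))) \<le> 1 / (1 - s)" if F: "finite F" for F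
  proof -
    obtain N where N: "F \<subseteq> {\<alpha>. length \<alpha> < N}"
      using F finite_nat_set_iff_bounded[of "length ` F"] by auto
    have "(\<Sum>\<alpha>\<in>F. norm (prod_list (map x \<alpha>))) \<le> (\<Sum>\<alpha> | length \<alpha> < N. norm (prod_list (map x \<alpha>)))"
      using N by (intro sum_mono2 finite_words) auto
    also have "\<dots> = (\<Sum>n<N. s ^ n)" unfolding norm_eq sum_words_shorter_than s_def ..
    also have "\<dots> \<le> (\<Sum>n. s ^ n)" using s by (intro sum_le_suminf summable_geometric) auto
    also have "\<dots> = 1 / (1 - s)" using s by (intro suminf_geometric) auto
    finally show ?thesis .
  qed
  have "(\<lambda>\<alpha>. norm (prod_list (map x \<alpha>))) summable_on UNIV"
    by (rule nonneg_bdd_above_summable_on) (auto intro!: bdd_aboveI[of _ "1 / (1 - s)"] le)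
  then have "(\<lambda>\<alpha>. prod_list (map x \<alpha>)) summable_on UNIV" by (rule abs_summable_summable)
  then obtain a where a: "((\<lambda>\<alpha>. prod_list (map x \<alpha>)) has_sum a) UNIV" by (auto simp: summable_on_def)
  have "filterlim (\<lambda>N. {\<alpha> :: 'd list. length \<alpha> < N}) (finite_subsets_at_top UNIV) sequentially"
    unfolding filterlim_finite_subsets_at_top
  proof (intro allI impI)
    fix F :: "'d list set" assume "finite F \<and> F \<subseteq> UNIV"
    then obtain N where N: "F \<subseteq> {\<alpha>. length \<alpha> < N}"
      using finite_nat_set_iff_bounded[of "length ` F"] by auto
    show "\<forall>\<^sub>F n in sequentially. finite {\<alpha> :: 'd list. length \<alpha> < n} \<and>
        F \<subseteq> {\<alpha>. length \<alpha> < n} \<and> {\<alpha> :: 'd list. length \<alpha> < n} \<subseteq> UNIV"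
      using eventually_ge_at_top[of N] by eventually_elim (use N finite_words in auto)
  qed
  with a have "(\<lambda>N. \<Sum>\<alpha> | length \<alpha> < N. prod_list (map x \<alpha>)) \<longlonglongrightarrow> a"
    unfolding has_sum_def by (rule filterlim_compose)
  moreover have "(\<lambda>N. \<Sum>\<alpha> | length \<alpha> < N. prod_list (map x \<alpha>)) \<longlonglongrightarrow> 1 / (1 - (\<Sum>j\<in>UNIV. x j))"
    unfolding sum_words_shorter_than sums_def[symmetric]
  proof (rule geometric_sums)
    show "norm (\<Sum>j\<in>UNIV. x j) < 1" using norm_sum[of x UNIV] assms by linarith
  qed
  ultimately have "a = 1 / (1 - (\<Sum>j\<in>UNIV. x j))" by (rule LIMSEQ_unique)
  with a show ?thesis by simp
qed

lemma sum_norm_cinner_less_1: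
  fixes z w :: "complex ^ 'd"
  assumes "z \<in> ball 0 1" "w \<in> ball 0 1"
  shows "(\<Sum>j\<in>UNIV. norm (z $ j * cnj (w $ j))) < 1"
proof -
  have "(\<Sum>j\<in>UNIV. norm (z $ j * cnj (w $ j))) \<le> norm z * norm w"
    unfolding norm_vec_def using L2_set_mult_ineq[of "\<lambda>j. norm (z $ j)" "\<lambda>j. norm (w $ j)" UNIV]
    by (simp add: norm_mult)
  also have "\<dots> < 1" using mult_left_le[of "norm w" "norm z"] assms by simp
  finally show ?thesis .
qed

text \<open>Indexing the features by words, that is by noncommutative monomials, realizes the kernel
\<open>\<Sum>n. \<langle>z, w\<rangle> ^ n\<close> without multinomial coefficients; the resulting features are far from
independent, which \<open>rkhs_of_feature_map\<close> tolerates.\<close>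

definition word_feature :: "complex ^ 'd \<Rightarrow> 'd list \<Rightarrow> complex" where
  "word_feature z \<alpha> = cnj (prod_list (map (\<lambda>j. z $ j) \<alpha>))"

lemma word_feature_product:
  "word_feature w \<alpha> * cnj (word_feature z \<alpha>) = prod_list (map (\<lambda>j. z $ j * cnj (w $ j)) \<alpha>)"
  unfolding word_feature_def by (induction \<alpha>) (auto simp: mult_ac)

lemma drury_arveson_rkhs_exists:
  "\<exists>F ipF. reproducing_kernel_hilbert_space (ball 0 1) (drury_arveson_kernel :: complex ^ 'd \<Rightarrow> _) F ipF"
proof (rule hilbert_function_space.rkhs_of_feature_map[OF square_summable_hilbert])
  fix w z :: "complex ^ 'd"
  assume w: "w \<in> ball 0 1"
  have "norm (prod_list (map (\<lambda>j. w $ j * cnj (w $ j)) \<alpha>)) = (cmod (word_feature w \<alpha>))\<^sup>2" for \<alpha>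
    unfolding word_feature_product[symmetric] by (simp add: norm_mult power2_eq_square)
  moreover have "(\<lambda>\<alpha>. norm (prod_list (map (\<lambda>j. w $ j * cnj (w $ j)) \<alpha>))) summable_on UNIV"
  proof -
    have "((\<lambda>\<alpha>. prod_list (map (\<lambda>j. w $ j * cnj (w $ j)) \<alpha>)) summable_on UNIV)"
      using has_sum_words[OF sum_norm_cinner_less_1[OF w w]] by (auto simp: summable_on_def)
    then show ?thesis by (simp add: summable_on_iff_abs_summable_on_complex)
  qed
  ultimately show "word_feature w \<in> square_summable" by (simp add: square_summable_def)
  assume z: "z \<in> ball 0 1"
  show "drury_arveson_kernel w z = (\<Sum>\<^sub>\<infinity>\<alpha>. word_feature w \<alpha> * cnj (word_feature z \<alpha>))"
    unfolding word_feature_product drury_arveson_kernel_def cinner_def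
    by (rule infsumI[symmetric], rule has_sum_words, rule sum_norm_cinner_less_1[OF z w])
qed

lemma drury_arveson_space_eq:
  "(drury_arveson_space :: (complex ^ 'd \<Rightarrow> complex) set)
   = {f \<in> extensional (ball 0 1). \<exists>C. gram_bounded (ball 0 1) drury_arveson_kernel C f}"
  using drury_arveson_rkhs_exists rkhs_eq_gram_bounded unfolding drury_arveson_space_def by blast

lemma drury_arveson_gram_form_nonneg:
  fixes S :: "(complex ^ 'd) set"
  assumes "finite S" "S \<subseteq> ball 0 1"
  shows "0 \<le> Re (gram_form drury_arveson_kernel S c)"
  using drury_arveson_rkhs_exists reproducing_kernel_hilbert_space.gram_form_nonneg[OF _ assms] by blast

section \<open>Power series in the diagonal coordinate\<close>

text \<open>This and the next function are the coordinates along the crossing point \<open>(1,1) / sqrt 2\<close> and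
orthogonal to it.\<close>

definition diag_coord :: "complex ^ 2 \<Rightarrow> complex" where
  "diag_coord z = (z $ 1 + z $ 2) / of_real (sqrt 2)"

definition antidiag_coord :: "complex ^ 2 \<Rightarrow> complex" where
  "antidiag_coord z = (z $ 1 - z $ 2) / of_real (sqrt 2)"

lemma cinner_diag:
  "cinner z w = diag_coord z * cnj (diag_coord w) + antidiag_coord z * cnj (antidiag_coord w)"
proof -
  have s: "complex_of_real (sqrt 2) * complex_of_real (sqrt 2) = 2"
    by (simp flip: of_real_mult)
  have *: "(p / complex_of_real (sqrt 2)) * cnj (q / complex_of_real (sqrt 2)) = p * cnj q / 2" for p q
    by (simp only: complex_cnj_divide complex_cnj_complex_of_real times_divide_times_eq s)
  have "diag_coord z * cnj (diag_coord w) + antidiag_coord z * cnj (antidiag_coord w)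
      = ((z$1 + z$2) * cnj (w$1 + w$2) + (z$1 - z$2) * cnj (w$1 - w$2)) / 2"
    unfolding diag_coord_def antidiag_coord_def * by (rule add_divide_distrib[symmetric])
  also have "\<dots> = cinner z w" by (simp add: cinner_def sum_2 algebra_simps)
  finally show ?thesis ..
qed

lemma norm_cinner_less_1:
  assumes "z \<in> ball 0 1" "w \<in> ball 0 1"
  shows "norm (cinner z w) < 1"
  unfolding cinner_def using norm_sum sum_norm_cinner_less_1[OF assms] by (rule le_less_trans)

lemma norm_diag_coord_less_1:
  assumes "z \<in> ball 0 1" shows "norm (diag_coord z) < 1"
proof -
  have "complex_of_real ((norm (diag_coord z))\<^sup>2 + (norm (antidiag_coord z))\<^sup>2) = cinner z z"
    unfolding of_real_add complex_norm_square cinner_diag ..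
  then have "norm (cinner z z) = (norm (diag_coord z))\<^sup>2 + (norm (antidiag_coord z))\<^sup>2"
    by (metis norm_of_real abs_of_nonneg add_nonneg_nonneg zero_le_power2)
  then have "(norm (diag_coord z))\<^sup>2 < 1" using norm_cinner_less_1[OF assms assms] by (smt (verit) zero_le_power2)
  then show ?thesis by (simp add: power_less_one_iff abs_square_less_1)
qed

abbreviation da_form :: "(complex ^ 2) set \<Rightarrow> (complex ^ 2 \<Rightarrow> complex) \<Rightarrow> complex" where
  "da_form \<equiv> gram_form drury_arveson_kernel"

text \<open>Since \<open>\<langle>z,w\<rangle>\<close> is the sum of its diagonal and antidiagonal parts, the identity
\<open>K = 1 + \<langle>z,w\<rangle> K\<close> splits the kernel into three positive semidefinite pieces.\<close>

lemma gram_form_split: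
  assumes "S \<subseteq> ball 0 1"
  shows "da_form S c = da_form S (\<lambda>w. c w * cnj (diag_coord w))
     + da_form S (\<lambda>w. c w * cnj (antidiag_coord w)) + of_real ((cmod (\<Sum>w\<in>S. c w))\<^sup>2)"
proof -
  have kernel: "drury_arveson_kernel w v = diag_coord v * cnj (diag_coord w) * drury_arveson_kernel w v
      + antidiag_coord v * cnj (antidiag_coord w) * drury_arveson_kernel w v + 1"
    if "w \<in> S" "v \<in> S" for w v
  proof -
    have "cinner v w \<noteq> 1" using norm_cinner_less_1[of v w] that assms by fastforce
    then have "drury_arveson_kernel w v = cinner v w * drury_arveson_kernel w v + 1"
      by (simp add: drury_arveson_kernel_def field_simps)
    then show ?thesis by (simp add: cinner_diag algebra_simps)
  qed
  have "da_form S c = (\<Sum>w\<in>S. \<Sum>v\<in>S. c w * cnj (c v) * (diag_coord v * cnj (diag_coord w) * drury_arveson_kernel w v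
      + antidiag_coord v * cnj (antidiag_coord w) * drury_arveson_kernel w v + 1))"
    unfolding gram_form_def by (intro sum.cong refl) (simp only: kernel[symmetric])
  also have "\<dots> = da_form S (\<lambda>w. c w * cnj (diag_coord w))
     + da_form S (\<lambda>w. c w * cnj (antidiag_coord w)) + (\<Sum>w\<in>S. \<Sum>v\<in>S. c w * cnj (c v))"
    unfolding gram_form_def sum.distrib[symmetric]
    by (intro sum.cong refl) (simp add: algebra_simps)
  also have "(\<Sum>w\<in>S. \<Sum>v\<in>S. c w * cnj (c v)) = (\<Sum>w\<in>S. c w) * cnj (\<Sum>w\<in>S. c w)"
    by (simp add: sum_product)
  also have "\<dots> = of_real ((cmod (\<Sum>w\<in>S. c w))\<^sup>2)" by (rule complex_norm_square[symmetric])
  finally show ?thesis .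
qed

text \<open>Each multiplication by the diagonal coordinate costs the square of one sum, and the antidiagonal
piece is dropped. The two consequences that follow are the contractivity of multiplication by u and
the bound behind the isometric copy of the Hardy space inside the Drury-Arveson space.\<close>

lemma gram_form_telescope:
  assumes "finite S" "S \<subseteq> ball 0 1"
  shows "Re (da_form S (\<lambda>w. c w * cnj (diag_coord w) ^ N))
     + (\<Sum>n<N. (cmod (\<Sum>w\<in>S. cnj (c w) * diag_coord w ^ n))\<^sup>2) \<le> Re (da_form S c)"
proof (induction N)
  case (Suc N)
  let ?b = "\<lambda>w. c w * cnj (diag_coord w) ^ N"
  have "(\<Sum>w\<in>S. ?b w) = cnj (\<Sum>w\<in>S. cnj (c w) * diag_coord w ^ N)" by simp
  then have "(cmod (\<Sum>w\<in>S. ?b w))\<^sup>2 = (cmod (\<Sum>w\<in>S. cnj (c w) * diag_coord w ^ N))\<^sup>2"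
    by (simp only: complex_mod_cnj)
  moreover have "Re (da_form S ?b) = Re (da_form S (\<lambda>w. ?b w * cnj (diag_coord w)))
      + Re (da_form S (\<lambda>w. ?b w * cnj (antidiag_coord w))) + (cmod (\<Sum>w\<in>S. ?b w))\<^sup>2"
    using arg_cong[OF gram_form_split[OF assms(2), of ?b], of Re] by (simp only: plus_complex.sel Re_complex_of_real)
  moreover have "0 \<le> Re (da_form S (\<lambda>w. ?b w * cnj (antidiag_coord w)))"
    by (rule drury_arveson_gram_form_nonneg[OF assms])
  moreover have "(\<lambda>w. ?b w * cnj (diag_coord w)) = (\<lambda>w. c w * cnj (diag_coord w) ^ Suc N)"
    by (simp add: fun_eq_iff mult_ac)
  ultimately show ?case using Suc unfolding sum.lessThan_Suc by simp
qed simp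

lemma gram_form_mult_diag_le:
  assumes "finite S" "S \<subseteq> ball 0 1"
  shows "Re (da_form S (\<lambda>w. c w * cnj (diag_coord w) ^ n)) \<le> Re (da_form S c)"
  using gram_form_telescope[OF assms, of c n]
  by (smt (verit) sum_nonneg zero_le_power2)

lemma sum_squares_diag_powers_le:
  assumes "finite S" "S \<subseteq> ball 0 1"
  shows "(\<Sum>n<N. (cmod (\<Sum>w\<in>S. cnj (c w) * diag_coord w ^ n))\<^sup>2) \<le> Re (da_form S c)"
  using gram_form_telescope[OF assms, of c N]
    drury_arveson_gram_form_nonneg[OF assms, of "\<lambda>w. c w * cnj (diag_coord w) ^ N"] by linarith

lemma summable_power_series_disc:
  fixes a :: "nat \<Rightarrow> complex"
  assumes "Bseq a" "norm u < 1"
  shows "summable (\<lambda>n. a n * u ^ n)"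
proof -
  obtain B where B: "\<And>n. norm (a n) \<le> B" using assms(1) by (auto simp: Bseq_def)
  have "summable (\<lambda>n. B * norm u ^ n)" using assms(2) by (intro summable_mult summable_geometric) simp
  then show ?thesis
    by (rule summable_comparison_test') (auto simp: norm_mult norm_power intro!: mult_right_mono B)
qed

text \<open>By Cauchy-Schwarz in n the induced functional is controlled by the sums in
\<open>sum_squares_diag_powers_le\<close>.\<close>

lemma diag_power_series_mem:
  fixes a :: "nat \<Rightarrow> complex"
  assumes a: "summable (\<lambda>n. (cmod (a n))\<^sup>2)"
  shows "(\<lambda>z\<in>ball 0 1. \<Sum>n. a n * diag_coord z ^ n) \<in> drury_arveson_space"
proof -
  have "(\<lambda>n. (cmod (a n))\<^sup>2) \<longlonglongrightarrow> 0" using a by (rule summable_LIMSEQ_zero)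
  then have "(\<lambda>n. sqrt ((cmod (a n))\<^sup>2)) \<longlonglongrightarrow> sqrt 0" by (rule tendsto_real_sqrt)
  then have "a \<longlonglongrightarrow> 0" by (simp add: tendsto_norm_zero_iff)
  then have B: "Bseq a" using convergent_imp_Bseq convergentI by blast
  define D where "D = (\<Sum>n. (cmod (a n))\<^sup>2)"
  define f where "f = (\<lambda>z\<in>ball 0 1. \<Sum>n. a n * diag_coord z ^ n)"
  have "gram_bounded (ball 0 1) drury_arveson_kernel D f"
    unfolding gram_bounded_def
  proof (intro conjI allI impI)
    show "0 \<le> D" unfolding D_def by (intro suminf_nonneg a) simp
    fix S :: "(complex ^ 2) set" and c :: "complex ^ 2 \<Rightarrow> complex"
    assume S: "finite S" "S \<subseteq> ball 0 1"
    define A where "A n = (\<Sum>w\<in>S. cnj (c w) * diag_coord w ^ n)" for n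
    have sums: "(\<lambda>n. a n * diag_coord w ^ n) sums f w" if "w \<in> S" for w
      using summable_power_series_disc[OF B norm_diag_coord_less_1[of w]] that S
      by (auto simp: f_def summable_sums)
    have "(\<lambda>n. \<Sum>w\<in>S. cnj (c w) * (a n * diag_coord w ^ n)) sums (\<Sum>w\<in>S. cnj (c w) * f w)"
      by (intro sums_sum sums_mult sums)
    then have "(\<lambda>n. a n * A n) sums (\<Sum>w\<in>S. cnj (c w) * f w)"
      by (simp add: A_def sum_distrib_left mult_ac)
    then have lim: "(\<lambda>N. (cmod (\<Sum>n<N. a n * A n))\<^sup>2) \<longlonglongrightarrow> (cmod (\<Sum>w\<in>S. cnj (c w) * f w))\<^sup>2"
      unfolding sums_def by (intro tendsto_intros)
    have "(cmod (\<Sum>n<N. a n * A n))\<^sup>2 \<le> D * Re (da_form S c)" for N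
    proof -
      have "cmod (\<Sum>n<N. a n * A n) \<le> (\<Sum>n<N. cmod (a n) * cmod (A n))"
        by (rule order.trans[OF norm_sum]) (simp add: norm_mult)
      then have "(cmod (\<Sum>n<N. a n * A n))\<^sup>2 \<le> (\<Sum>n<N. cmod (a n) * cmod (A n))\<^sup>2"
        by (intro power_mono) auto
      also have "\<dots> \<le> (\<Sum>n<N. (cmod (a n))\<^sup>2) * (\<Sum>n<N. (cmod (A n))\<^sup>2)"
        by (rule Cauchy_Schwarz_ineq_sum)
      also have "\<dots> \<le> D * Re (da_form S c)"
        unfolding D_def A_def
        by (intro mult_mono sum_le_suminf a sum_squares_diag_powers_le S suminf_nonneg sum_nonneg) auto
      finally show ?thesis .
    qed
    then show "(cmod (\<Sum>w\<in>S. cnj (c w) * f w))\<^sup>2 \<le> D * Re (da_form S c)"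
      by (intro LIMSEQ_le_const2[OF lim]) blast
  qed
  then show ?thesis unfolding drury_arveson_space_eq f_def by auto
qed

text \<open>Each power of the diagonal coordinate is a contractive multiplier, so the series converges
absolutely in multiplier norm. On the level of Gram forms, multiplying f by the n-th power moves the conjugate of this power
into the coefficients, which does not increase the form.\<close>

lemma diag_power_series_multiplier:
  fixes a :: "nat \<Rightarrow> complex"
  assumes a: "summable (\<lambda>n. cmod (a n))"
  shows "(\<lambda>z\<in>ball 0 1. \<Sum>n. a n * diag_coord z ^ n) \<in> drury_arveson_multipliers"
proof -
  define D where "D = (\<Sum>n. cmod (a n))"
  have D0: "0 \<le> D" unfolding D_def by (intro suminf_nonneg a) simp
  define \<phi> where "\<phi> = (\<lambda>z\<in>ball 0 1. \<Sum>n. a n * diag_coord z ^ n)"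
  have "a \<longlonglongrightarrow> 0" using summable_LIMSEQ_zero[OF a] by (simp add: tendsto_norm_zero_iff)
  then have B: "Bseq a" using convergent_imp_Bseq convergentI by blast
  have "(\<lambda>z\<in>ball 0 1. \<phi> z * f z) \<in> drury_arveson_space" if f: "f \<in> drury_arveson_space" for f
  proof -
    obtain C where C: "gram_bounded (ball 0 1) drury_arveson_kernel C f"
      using f unfolding drury_arveson_space_eq by blast
    define g where "g = (\<lambda>z\<in>ball 0 1. \<phi> z * f z)"
    have "gram_bounded (ball 0 1) drury_arveson_kernel (D\<^sup>2 * C) g"
      unfolding gram_bounded_def
    proof (intro conjI allI impI)
      show "0 \<le> D\<^sup>2 * C" using C by (simp add: gram_bounded_def)
      fix S :: "(complex ^ 2) set" and c :: "complex ^ 2 \<Rightarrow> complex"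
      assume S: "finite S" "S \<subseteq> ball 0 1"
      define A where "A n = (\<Sum>w\<in>S. cnj (c w) * (diag_coord w ^ n * f w))" for n
      define R where "R = C * Re (da_form S c)"
      have A: "cmod (A n) \<le> sqrt R" for n
      proof (rule real_le_rsqrt)
        have "(cmod (A n))\<^sup>2 \<le> C * Re (da_form S (\<lambda>w. c w * cnj (diag_coord w) ^ n))"
        proof -
          have "A n = (\<Sum>w\<in>S. cnj (c w * cnj (diag_coord w) ^ n) * f w)"
            by (simp add: A_def mult.assoc)
          then show ?thesis using C S unfolding gram_bounded_def by metis
        qed
        also have "\<dots> \<le> R" unfolding R_def
          using gram_form_mult_diag_le[OF S] C by (intro mult_left_mono) (auto simp: gram_bounded_def)
        finally show "(cmod (A n))\<^sup>2 \<le> R" .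
      qed
      have R0: "0 \<le> R" using A[of 0] by (smt (verit) norm_ge_zero real_sqrt_lt_0_iff)
      have sums: "(\<lambda>n. a n * diag_coord w ^ n) sums \<phi> w" if "w \<in> S" for w
        using summable_power_series_disc[OF B norm_diag_coord_less_1[of w]] that S
        by (auto simp: \<phi>_def summable_sums)
      have "(\<lambda>n. \<Sum>w\<in>S. cnj (c w) * (a n * diag_coord w ^ n * f w)) sums (\<Sum>w\<in>S. cnj (c w) * (\<phi> w * f w))"
        by (intro sums_sum sums_mult sums_mult2 sums)
      then have "(\<lambda>n. a n * A n) sums (\<Sum>w\<in>S. cnj (c w) * (\<phi> w * f w))"
        by (simp add: A_def sum_distrib_left mult_ac)
      also have "(\<Sum>w\<in>S. cnj (c w) * (\<phi> w * f w)) = (\<Sum>w\<in>S. cnj (c w) * g w)"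
        using S by (intro sum.cong) (auto simp: g_def)
      finally have lim: "(\<lambda>N. cmod (\<Sum>n<N. a n * A n)) \<longlonglongrightarrow> cmod (\<Sum>w\<in>S. cnj (c w) * g w)"
        unfolding sums_def by (intro tendsto_intros)
      have "cmod (\<Sum>n<N. a n * A n) \<le> D * sqrt R" for N
      proof -
        have "cmod (\<Sum>n<N. a n * A n) \<le> (\<Sum>n<N. cmod (a n) * sqrt R)"
          by (rule order.trans[OF norm_sum]) (auto simp: norm_mult intro!: sum_mono mult_left_mono A)
        also have "\<dots> \<le> D * sqrt R"
          unfolding D_def sum_distrib_right[symmetric]
          by (intro mult_right_mono sum_le_suminf a) (auto simp: R0)
        finally show ?thesis .
      qed
      then have "cmod (\<Sum>w\<in>S. cnj (c w) * g w) \<le> D * sqrt R"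
        by (intro LIMSEQ_le_const2[OF lim]) blast
      then have "(cmod (\<Sum>w\<in>S. cnj (c w) * g w))\<^sup>2 \<le> (D * sqrt R)\<^sup>2"
        by (intro power_mono) auto
      then show "(cmod (\<Sum>w\<in>S. cnj (c w) * g w))\<^sup>2 \<le> D\<^sup>2 * C * Re (da_form S c)"
        using R0 by (simp add: power_mult_distrib R_def mult.assoc)
    qed
    then show ?thesis unfolding drury_arveson_space_eq g_def by auto
  qed
  then show ?thesis unfolding drury_arveson_multipliers_def multipliers_def \<phi>_def by auto
qed

section \<open>Exchanging the two coordinates\<close>

definition real_point :: "real \<Rightarrow> real \<Rightarrow> complex ^ 2" where
  "real_point p q = (1 / sqrt 2) *\<^sub>R vector [of_real p, of_real q]"

lemma real_point_nth: "real_point p q $ 1 = of_real (p / sqrt 2)" "real_point p q $ 2 = of_real (q / sqrt 2)"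
  by (simp_all add: real_point_def complex_eq_iff)

lemma cinner_real_point: "cinner (real_point p q) (real_point p' q') = of_real ((p * p' + q * q') / 2)"
proof -
  have "p / sqrt 2 * (p' / sqrt 2) + q / sqrt 2 * (q' / sqrt 2) = (p * p' + q * q') / 2"
    by (simp add: add_divide_distrib)
  then show ?thesis
    by (simp only: cinner_def sum_2 real_point_nth complex_cnj_complex_of_real of_real_mult[symmetric] of_real_add[symmetric])
qed

lemma real_point_in_ball:
  assumes "0 \<le> p" "p < 1" "0 \<le> q" "q < 1"
  shows "real_point p q \<in> ball 0 1"
proof -
  have "(norm (real_point p q))\<^sup>2 = p\<^sup>2 / 2 + q\<^sup>2 / 2"
    by (simp add: norm_vec_def L2_set_def sum_2 real_point_nth norm_divide power_divide)
  moreover have "p\<^sup>2 < 1" "q\<^sup>2 < 1" using assms by (simp_all add: power_less_one_iff abs_square_less_1)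
  ultimately have "(norm (real_point p q))\<^sup>2 < 1" by linarith
  then show ?thesis by (simp add: abs_square_less_1)
qed

lemma diag_coord_real_point: "diag_coord (real_point p q) = of_real ((p + q) / 2)"
proof -
  have "(p / sqrt 2 + q / sqrt 2) / sqrt 2 = (p + q) / 2"
    by (simp add: add_divide_distrib)
  then show ?thesis
    by (simp only: diag_coord_def real_point_nth of_real_divide[symmetric] of_real_add[symmetric])
qed

text \<open>The left-hand side is half the squared distance between the kernel functions at \<open>(p,q) / sqrt 2\<close>
and \<open>(q,p) / sqrt 2\<close>. With \<open>e = 1 - p\<close> and \<open>d = 1 - q\<close> it has numerator \<open>(e - d)\<^sup>2 / 2\<close>, while its two
denominators are at least \<open>\<bar>e - d\<bar> / 2\<close> and \<open>\<bar>e - d\<bar>\<close>.\<close>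

lemma swap_kernel_estimate:
  fixes p q :: real
  assumes "0 \<le> p" "p < 1" "0 \<le> q" "q < 1"
  shows "1 / (1 - (p * p + q * q) / 2) - 1 / (1 - p * q) \<le> 1"
proof -
  define e d where "e = 1 - p" and "d = 1 - q"
  have ed: "0 < e" "e \<le> 1" "0 < d" "d \<le> 1" using assms by (auto simp: e_def d_def)
  have p: "p = 1 - e" and q: "q = 1 - d" by (auto simp: e_def d_def)
  have A: "1 - p * q \<ge> \<bar>e - d\<bar>"
  proof -
    have "e * d \<le> e" "e * d \<le> d" using ed mult_left_le[of d e] mult_left_le[of e d] by (auto simp: mult.commute)
    then show ?thesis using ed unfolding p q by (simp add: algebra_simps abs_if)
  qed
  have B: "1 - (p * p + q * q) / 2 \<ge> \<bar>e - d\<bar> / 2"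
  proof -
    have "e * e \<le> e" "d * d \<le> d" using ed mult_left_le[of e e] mult_left_le[of d d] by auto
    moreover have "1 - (p * p + q * q) / 2 = e + d - (e * e + d * d) / 2"
      unfolding p q by (simp add: field_simps)
    moreover have "\<bar>e - d\<bar> / 2 \<le> (e + d) / 2" using ed by (intro divide_right_mono) auto
    ultimately show ?thesis by (simp add: field_simps)
  qed
  have pq: "p * p < 1" "q * q < 1" "p * q < 1"
    using assms mult_left_le[of p p] mult_left_le[of q q] mult_left_le[of q p] by auto
  then have pos: "1 - (p * p + q * q) / 2 > 0" "1 - p * q > 0" by auto
  have "(p - q)\<^sup>2 / 2 = \<bar>e - d\<bar> / 2 * \<bar>e - d\<bar>"
    unfolding p q by (simp add: power2_eq_square abs_if algebra_simps)
  also have "\<dots> \<le> (1 - (p * p + q * q) / 2) * (1 - p * q)"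
    using A B pos by (intro mult_mono) auto
  finally have "(p - q)\<^sup>2 / 2 / ((1 - (p * p + q * q) / 2) * (1 - p * q)) \<le> 1"
    using pos by (subst divide_le_eq_1_pos) auto
  moreover have "1 / (1 - (p * p + q * q) / 2) - 1 / (1 - p * q)
      = (p - q)\<^sup>2 / 2 / ((1 - (p * p + q * q) / 2) * (1 - p * q))"
  proof -
    have num: "(1 - p * q) - (1 - (p * p + q * q) / 2) = (p - q)\<^sup>2 / 2"
      by (simp add: power2_eq_square algebra_simps add_divide_distrib diff_divide_distrib)
    have "1 - (p * p + q * q) / 2 \<noteq> 0" "1 - p * q \<noteq> 0" using pos by auto
    then show ?thesis by (simp only: diff_frac_eq[OF \<open>1 - (p * p + q * q) / 2 \<noteq> 0\<close> \<open>1 - p * q \<noteq> 0\<close>] mult_1_left num)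
  qed
  ultimately show ?thesis by simp
qed

text \<open>The bound is uniform up to the crossing point \<open>p = q = 1\<close>, where point evaluations are unbounded.\<close>

lemma swap_difference_bounded:
  assumes h: "h \<in> drury_arveson_space"
  shows "\<exists>C. \<forall>p q. 0 \<le> p \<longrightarrow> p < 1 \<longrightarrow> 0 \<le> q \<longrightarrow> q < 1 \<longrightarrow>
    cmod (h (real_point p q) - h (real_point q p)) \<le> C"
proof -
  obtain C where C: "gram_bounded (ball 0 1) drury_arveson_kernel C h"
    using h unfolding drury_arveson_space_eq by blast
  have C0: "0 \<le> C" using C by (simp add: gram_bounded_def)
  have "cmod (h (real_point p q) - h (real_point q p)) \<le> sqrt (2 * C)"
    if pq: "0 \<le> p" "p < 1" "0 \<le> q" "q < 1" for p q
  proof (cases "real_point p q = real_point q p")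
    case False
    define a b where "a = real_point p q" and "b = real_point q p"
    have ab: "a \<noteq> b" using False by (simp add: a_def b_def)
    have S: "finite {a, b}" "{a, b} \<subseteq> ball 0 1"
      using pq real_point_in_ball by (auto simp: a_def b_def)
    \<comment> \<open>The coefficients of the difference of the two kernel functions.\<close>
    define c where "c w = (if w = a then 1 else - 1 :: complex)" for w
    have "Re (da_form {a, b} c) = 2 * (1 / (1 - (p * p + q * q) / 2) - 1 / (1 - p * q))"
    proof -
      have "cinner a a = of_real ((p * p + q * q) / 2)" "cinner b b = of_real ((p * p + q * q) / 2)"
        "cinner a b = of_real (p * q)" "cinner b a = of_real (p * q)"
        by (simp_all add: a_def b_def cinner_real_point algebra_simps)
      then have "drury_arveson_kernel a a = of_real (1 / (1 - (p * p + q * q) / 2))"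
        "drury_arveson_kernel b b = of_real (1 / (1 - (p * p + q * q) / 2))"
        "drury_arveson_kernel a b = of_real (1 / (1 - p * q))"
        "drury_arveson_kernel b a = of_real (1 / (1 - p * q))"
        by (simp_all add: drury_arveson_kernel_def)
      moreover have "da_form {a, b} c = drury_arveson_kernel a a - drury_arveson_kernel a b
          - drury_arveson_kernel b a + drury_arveson_kernel b b"
        using ab by (simp add: gram_form_def c_def)
      moreover have "x - y - y + x = 2 * (x - y)" for x y :: real by simp
      ultimately show ?thesis by (simp only: minus_complex.sel plus_complex.sel Re_complex_of_real)
    qed
    then have "Re (da_form {a, b} c) \<le> 2" using swap_kernel_estimate[OF pq] by simp
    moreover have "(cmod (\<Sum>w\<in>{a, b}. cnj (c w) * h w))\<^sup>2 \<le> C * Re (da_form {a, b} c)"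
      using C S unfolding gram_bounded_def by blast
    moreover have "(\<Sum>w\<in>{a, b}. cnj (c w) * h w) = h a - h b" using ab by (simp add: c_def)
    ultimately have "(cmod (h a - h b))\<^sup>2 \<le> 2 * C"
      using mult_left_mono[of "Re (da_form {a, b} c)" 2 C] C0 by simp
    then show ?thesis unfolding a_def b_def by (rule real_le_rsqrt)
  qed (use C0 in simp)
  then show ?thesis by blast
qed

section \<open>Multipliers on the crossing discs\<close>

lemma disc_multipliers_pullback:
  assumes "inj_on f (ball 0 1)" "\<phi> \<in> disc_multipliers f"
  obtains \<Psi> where "\<Psi> \<in> drury_arveson_multipliers" "\<And>z. z \<in> ball 0 1 \<Longrightarrow> \<phi> z = \<Psi> (f z)"
proof -
  obtain \<Psi> where \<Psi>: "\<Psi> \<in> drury_arveson_multipliers"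
    "restrict (\<phi> \<circ> the_inv_into (ball 0 1) f) (f ` ball 0 1) = restrict \<Psi> (f ` ball 0 1)"
    using assms(2) unfolding disc_multipliers_def variety_multipliers_def by auto
  have "\<phi> z = \<Psi> (f z)" if "z \<in> ball 0 1" for z
    using fun_cong[OF \<Psi>(2), of "f z"] that the_inv_into_f_f[OF assms(1) that] by simp
  with \<Psi>(1) show ?thesis using that by blast
qed

lemma pullback_in_disc_multipliers:
  assumes "inj_on f (ball 0 1)" "\<Psi> \<in> drury_arveson_multipliers"
  shows "(\<lambda>z\<in>ball 0 1. \<Psi> (f z)) \<in> disc_multipliers f"
proof -
  have "restrict ((\<lambda>z\<in>ball 0 1. \<Psi> (f z)) \<circ> the_inv_into (ball 0 1) f) (f ` ball 0 1) = restrict \<Psi> (f ` ball 0 1)"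
    using assms(1) by (auto simp: fun_eq_iff the_inv_into_f_f simp del: mem_ball)
  then show ?thesis using assms(2) unfolding disc_multipliers_def variety_multipliers_def by auto
qed

text \<open>Equal squares leave only \<open>z = - w\<close> to exclude. Then \<open>b(z) = \<plusminus> b(-z)\<close>, which forces \<open>z = 0\<close> for the
sign + and \<open>z\<^sup>2 = 1\<close> for the sign -; the latter is the crossing at \<open>\<plusminus>1\<close>, on the boundary.\<close>

lemma crossing_disc_inj:
  assumes r: "0 < r" "r < 1"
  shows "inj_on (crossing_disc r) (ball 0 1)"
proof (rule inj_onI)
  fix z w :: complex
  assume zw: "z \<in> ball 0 1" "w \<in> ball 0 1" and eq: "crossing_disc r z = crossing_disc r w"
  have "(vector [z\<^sup>2, (disc_aut r z)\<^sup>2] :: complex ^ 2) = vector [w\<^sup>2, (disc_aut r w)\<^sup>2]"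
    using eq by (simp add: crossing_disc_def)
  then have "z\<^sup>2 = w\<^sup>2" and b: "(disc_aut r z)\<^sup>2 = (disc_aut r w)\<^sup>2"
    by (metis vector_2)+
  then consider "z = w" | "z = - w" by (auto simp: power2_eq_iff)
  then show "z = w"
  proof cases
    case 2
    have den: "1 - of_real r * x \<noteq> 0" if "norm x < 1" for x :: complex
    proof
      assume "1 - of_real r * x = 0"
      then have "norm (of_real r * x) = 1" by simp
      moreover have "norm (of_real r * x) \<le> norm x"
        using r by (simp add: norm_mult mult_left_le_one_le)
      ultimately show False using that by simp
    qed
    have d: "1 - of_real r * w \<noteq> 0" "1 + of_real r * w \<noteq> 0" using den[of w] den[of "-w"] zw by auto
    have "((- w - of_real r) / (1 + of_real r * w))\<^sup>2 = ((w - of_real r) / (1 - of_real r * w))\<^sup>2"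
      using b 2 by (simp add: disc_aut_def)
    then consider "(- w - of_real r) / (1 + of_real r * w) = (w - of_real r) / (1 - of_real r * w)"
      | "(- w - of_real r) / (1 + of_real r * w) = - ((w - of_real r) / (1 - of_real r * w))"
      by (auto simp: power2_eq_iff)
    then have "w = 0"
    proof cases
      case 1
      then have "(- w - of_real r) * (1 - of_real r * w) = (w - of_real r) * (1 + of_real r * w)"
        using d by (simp add: frac_eq_eq)
      then have "w * (1 - (of_real r)\<^sup>2) = 0" by (simp add: algebra_simps power2_eq_square)
      moreover have "(of_real r :: complex)\<^sup>2 \<noteq> 1"
        using r by (metis abs_of_pos less_irrefl of_real_1 of_real_eq_iff of_real_power power2_eq_1_iff neg_less_0_iff_less not_less_iff_gr_or_eq zero_less_one)
      ultimately show ?thesis by simp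
    next
      case 2
      then have "(- w - of_real r) / (1 + of_real r * w) = (- (w - of_real r)) / (1 - of_real r * w)"
        by (simp only: minus_divide_left)
      then have "(- w - of_real r) * (1 - of_real r * w) = - (w - of_real r) * (1 + of_real r * w)"
        using frac_eq_eq[THEN iffD1, OF d(2) d(1)] by blast
      then have "of_real r * (w\<^sup>2 - 1) = 0" by (simp add: algebra_simps power2_eq_square)
      then have "w\<^sup>2 = 1" using r by simp
      then have "norm (w\<^sup>2) = 1" by simp
      then have "norm w = 1" using norm_ge_zero[of w] by (auto simp: norm_power power2_eq_1_iff)
      then show ?thesis using zw by simp
    qed
    then show ?thesis using 2 by simp
  qed
qed

text \<open>The negative of \<open>disc_aut r\<close> on the real line. Since the disc depends on the square of
\<open>disc_aut r\<close> only, the sign is free, and this choice makes the map an involution.\<close>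

definition swap_real :: "real \<Rightarrow> real \<Rightarrow> real" where
  "swap_real r x = (r - x) / (1 - r * x)"

lemma swap_real_denominator:
  fixes r x :: real
  assumes "0 < r" "r < 1" "\<bar>x\<bar> < 1" shows "0 < 1 - r * x"
proof -
  have "\<bar>r * x\<bar> < 1" using assms mult_strict_mono'[of r 1 "\<bar>x\<bar>" 1] by (simp add: abs_mult)
  then show ?thesis by linarith
qed

lemma one_minus_swap_real_square:
  assumes "0 < r" "r < 1" "\<bar>x\<bar> < 1"
  shows "1 - (swap_real r x)\<^sup>2 = (1 - x\<^sup>2) * ((1 - r\<^sup>2) / (1 - r * x)\<^sup>2)"
proof -
  have d: "(1 - r * x)\<^sup>2 \<noteq> 0" using swap_real_denominator[OF assms] by simp
  have "1 - (swap_real r x)\<^sup>2 = ((1 - r * x)\<^sup>2 - (r - x)\<^sup>2) / (1 - r * x)\<^sup>2"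
    by (simp only: swap_real_def power_divide diff_divide_distrib[of "(1 - r * x)\<^sup>2"] divide_self[OF d])
  also have "(1 - r * x)\<^sup>2 - (r - x)\<^sup>2 = (1 - x\<^sup>2) * (1 - r\<^sup>2)"
    by (simp add: power2_eq_square algebra_simps)
  finally show ?thesis by simp
qed

lemma abs_swap_real_less_1:
  assumes "0 < r" "r < 1" "\<bar>x\<bar> < 1" shows "\<bar>swap_real r x\<bar> < 1"
proof -
  have "x\<^sup>2 < 1" "r\<^sup>2 < 1" using assms by (simp_all add: abs_square_less_1)
  then have "0 < (1 - x\<^sup>2) * ((1 - r\<^sup>2) / (1 - r * x)\<^sup>2)"
    using swap_real_denominator[OF assms] by simp
  then have "(swap_real r x)\<^sup>2 < 1" using one_minus_swap_real_square[OF assms] by linarith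
  then show ?thesis by (simp add: abs_square_less_1)
qed

lemma swap_real_involution:
  assumes "0 < r" "r < 1" "\<bar>x\<bar> < 1" shows "swap_real r (swap_real r x) = x"
proof -
  have d: "1 - r * x \<noteq> 0" using swap_real_denominator[OF assms] by simp
  have "r - swap_real r x = x * (1 - r\<^sup>2) / (1 - r * x)" "1 - r * swap_real r x = (1 - r\<^sup>2) / (1 - r * x)"
    unfolding swap_real_def using d by (simp_all add: field_simps power2_eq_square)
  moreover have "1 - r\<^sup>2 \<noteq> 0" using assms by (simp add: power2_eq_1_iff)
  ultimately show ?thesis using d by (simp add: swap_real_def[of r "swap_real r x"])
qed

lemma crossing_disc_real:
  "crossing_disc r (of_real x) = real_point (x\<^sup>2) ((swap_real r x)\<^sup>2)"
proof -
  have "disc_aut r (of_real x) = - of_real (swap_real r x)"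
    unfolding disc_aut_def swap_real_def of_real_divide minus_divide_left by simp
  then show ?thesis by (simp add: crossing_disc_def real_point_def)
qed

section \<open>A test function and a multiplier\<close>

text \<open>With exponent e in place of -5/8 the coefficients are square-summable for \<open>e < -1/2\<close>, and the series
grows like \<open>(1 - u) powr (- (1 + e))\<close>, which outweighs the multiplier \<open>(1 - u) powr (1/4)\<close> for \<open>e > -3/4\<close>;
-5/8 is the midpoint.\<close>

lemma test_coeff_square_summable: "summable (\<lambda>n. (cmod (of_real (real (Suc n) powr (-5/8))))\<^sup>2)"
proof -
  have "summable (\<lambda>n. real n powr (-5/4))" by (subst summable_real_powr_iff) simp
  then have "summable (\<lambda>n. real (Suc n) powr (-5/4))" by (simp only: summable_Suc_iff[of "\<lambda>n. real n powr (-5/4)"])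
  moreover have "(cmod (of_real (real (Suc n) powr (-5/8))))\<^sup>2 = real (Suc n) powr (-5/4)" for n
    by (simp add: power2_eq_square flip: powr_add)
  ultimately show ?thesis by presburger
qed

lemma test_series_summable:
  assumes "0 \<le> u" "u < (1::real)"
  shows "summable (\<lambda>n. real (Suc n) powr (-5/8) * u ^ n)"
proof (rule summable_comparison_test')
  show "summable (\<lambda>n. u ^ n)" using assms by (intro summable_geometric) simp
  fix n :: nat
  have "real (Suc n) powr (-5/8) \<le> real (Suc n) powr 0" by (intro powr_mono) auto
  then show "norm (real (Suc n) powr (-5/8) * u ^ n) \<le> u ^ n"
    using assms by (simp add: abs_mult mult_left_le_one_le)
qed

text \<open>The first \<open>1 / (2 (1 - u))\<close> terms suffice: there \<open>u ^ n \<ge> 1/2\<close> by Bernoulli's inequality.\<close>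

lemma test_series_lower_bound:
  assumes u: "0 \<le> u" "u < (1::real)"
  shows "(1 - u) powr (-3/8) / 4 \<le> (\<Sum>n. real (Suc n) powr (-5/8) * u ^ n)"
proof -
  \<comment> \<open>X is the largest exponent for which Bernoulli's inequality still gives 1/2.\<close>
  define X where "X = 1 / (2 * (1 - u))"
  define N where "N = nat \<lfloor>X\<rfloor>"
  have X: "X > 0" using u by (simp add: X_def)
  have NX: "real N \<le> X" "X \<le> real (Suc N)" using X by (auto simp: N_def; linarith)+
  have half: "1 / 2 \<le> u ^ n" if "n \<le> N" for n
  proof -
    have "real n * (1 - u) \<le> X * (1 - u)" using that NX u by (intro mult_right_mono) auto
    also have "\<dots> = 1 / 2" using u by (simp add: X_def)
    finally have "1 / 2 \<le> 1 + real n * (u - 1)" by (simp add: algebra_simps)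
    also have "\<dots> \<le> (1 + (u - 1)) ^ n" using u by (intro Bernoulli_inequality) auto
    finally show ?thesis by simp
  qed
  have "(1 - u) powr (-3/8) / 4 \<le> X powr (3/8) / 2"
  proof -
    have "X powr (3/8) = (1/2) powr (3/8) * (1 - u) powr (-3/8)"
    proof -
      have "X = 1 / 2 * (1 / (1 - u))" by (simp add: X_def)
      moreover have "(1 / (1 - u)) powr (3/8) = (1 - u) powr (-3/8)"
        using u by (simp add: powr_divide powr_minus_divide)
      ultimately show ?thesis using u by (simp only: powr_mult)
    qed
    moreover have "(1/2 :: real) powr 1 \<le> (1/2) powr (3/8)" by (intro powr_mono') auto
    moreover have "(1 - u) powr (-3/8) * (1/2) \<le> (1 - u) powr (-3/8) * (1/2) powr (3/8)"
      using calculation by (intro mult_left_mono) auto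
    ultimately show ?thesis by (simp add: mult.commute)
  qed
  also have "\<dots> \<le> real (Suc N) powr (3/8) / 2" using X NX by (intro divide_right_mono powr_mono2) auto
  also have "real (Suc N) powr (3/8) / 2 = real (Suc N) * (real (Suc N) powr (-5/8) * (1/2))"
  proof -
    have "real (Suc N) powr (3/8) = real (Suc N) powr 1 * real (Suc N) powr (-5/8)"
      using powr_add[of "real (Suc N)" 1 "-5/8"] by simp
    then show ?thesis by simp
  qed
  also have "\<dots> = (\<Sum>n<Suc N. real (Suc N) powr (-5/8) * (1/2))" by simp
  also have "\<dots> \<le> (\<Sum>n<Suc N. real (Suc n) powr (-5/8) * u ^ n)"
  proof (intro sum_mono mult_mono half)
    fix n assume "n \<in> {..<Suc N}"
    then show "real (Suc N) powr (-5/8) \<le> real (Suc n) powr (-5/8)" by (intro powr_mono2') auto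
  qed auto
  also have "\<dots> \<le> (\<Sum>n. real (Suc n) powr (-5/8) * u ^ n)"
    using u by (intro sum_le_suminf test_series_summable) auto
  finally show ?thesis .
qed

text \<open>All coefficients of \<open>(1 - u) powr (1/4)\<close> after the first are nonpositive, and the function stays
between 0 and 1, so their partial sums are bounded by letting u tend to 1.\<close>

lemma fourth_root_series:
  obtains b :: "nat \<Rightarrow> real"
  where "summable (\<lambda>n. \<bar>b n\<bar>)" "\<And>u. 0 \<le> u \<Longrightarrow> u < 1 \<Longrightarrow> (\<lambda>n. b n * u ^ n) sums (1 - u) powr (1/4)"
proof
  define b where "b n = ((1/4 :: real) gchoose n) * (-1) ^ n" for n
  show sums: "(\<lambda>n. b n * u ^ n) sums (1 - u) powr (1/4)" if u: "0 \<le> u" "u < 1" for u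
  proof -
    have "(\<lambda>n. ((1/4 :: real) gchoose n) * (-u) ^ n) sums (1 + (-u)) powr (1/4)"
      using u by (intro gen_binomial_real) simp
    moreover have "(-u) ^ n = (-1) ^ n * u ^ n" for n by (rule power_minus)
    ultimately show ?thesis by (simp add: b_def mult.assoc)
  qed
  have b0: "b 0 = 1" by (simp add: b_def)
  have rec: "b (Suc n) = b n * ((real n - 1/4) / real (Suc n))" for n
  proof -
    have "((1/4 :: real) gchoose Suc n) = ((1/4) gchoose n) * ((1/4 - real n) / real (Suc n))"
      by (simp add: gbinomial_prod_rev atLeast0_lessThan_Suc mult_ac)
    moreover have "(real n - 1/4) / real (Suc n) = - ((1/4 - real n) / real (Suc n))"
      by (simp only: minus_divide_left minus_diff_eq)
    ultimately show ?thesis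
      by (simp only: b_def power_Suc mult_ac mult_minus_left mult_minus_right mult_1_left)
  qed
  have neg: "b (Suc n) \<le> 0" for n
  proof (induction n)
    case 0 show ?case using rec[of 0] b0 by simp
  next
    case (Suc n)
    have "0 \<le> (real (Suc n) - 1/4) / real (Suc (Suc n))" by simp
    then show ?case unfolding rec[of "Suc n"] using Suc by (rule mult_nonpos_nonneg[rotated])
  qed
  have partial: "(\<Sum>n<N. - b (Suc n) * u ^ Suc n) \<le> 1" if u: "0 \<le> u" "u < 1" for u N
  proof -
    have "(\<lambda>n. b (Suc n) * u ^ Suc n) sums ((1 - u) powr (1/4) - 1)"
      using sums[OF u] b0 by (subst sums_Suc_iff) simp
    then have s: "(\<lambda>n. - b (Suc n) * u ^ Suc n) sums (1 - (1 - u) powr (1/4))"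
      using sums_minus by fastforce
    have "(\<Sum>n<N. - b (Suc n) * u ^ Suc n) \<le> (\<Sum>n. - b (Suc n) * u ^ Suc n)"
      using s neg u by (intro sum_le_suminf) (auto simp: sums_iff mult_nonpos_nonneg)
    also have "\<dots> = 1 - (1 - u) powr (1/4)" using s by (simp add: sums_iff)
    finally show ?thesis using powr_ge_zero[of "1 - u" "1/4"] by linarith
  qed
  have "(\<Sum>n<N. - b (Suc n)) \<le> 1" for N
  proof (rule tendsto_upperbound)
    have "((\<lambda>u. \<Sum>n<N. - b (Suc n) * u ^ Suc n) \<longlongrightarrow> (\<Sum>n<N. - b (Suc n) * 1 ^ Suc n)) (at_left 1)"
      by (intro tendsto_intros)
    then show "((\<lambda>u. \<Sum>n<N. - b (Suc n) * u ^ Suc n) \<longlongrightarrow> (\<Sum>n<N. - b (Suc n))) (at_left 1)" by simp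
    have "\<forall>\<^sub>F u in at_left 1. u \<in> {0<..<1::real}" by (rule eventually_at_leftI[of 0]) auto
    then show "\<forall>\<^sub>F u in at_left 1. (\<Sum>n<N. - b (Suc n) * u ^ Suc n) \<le> 1"
      by eventually_elim (use partial in auto)
  qed simp
  then have "summable (\<lambda>n. - b (Suc n))"
    by (intro summableI_nonneg_bounded[where x = 1]) (use neg in auto)
  moreover have "\<bar>b (Suc n)\<bar> = - b (Suc n)" for n using neg[of n] by simp
  ultimately have "summable (\<lambda>n. \<bar>b (Suc n)\<bar>)" by presburger
  then show "summable (\<lambda>n. \<bar>b n\<bar>)" by (subst (asm) summable_Suc_iff)
qed

section \<open>Decay across the self-crossing\<close>

text \<open>The value of the diagonal coordinate on the disc at a real parameter x. It equals 1 at \<open>x = \<plusminus>1\<close>, the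
two parameters of the crossing point.\<close>

definition crossing_diag :: "real \<Rightarrow> real \<Rightarrow> real" where
  "crossing_diag r x = (x\<^sup>2 + (swap_real r x)\<^sup>2) / 2"

lemma diag_coord_crossing: "diag_coord (real_point (x\<^sup>2) ((swap_real r x)\<^sup>2)) = of_real (crossing_diag r x)"
  "diag_coord (real_point ((swap_real r x)\<^sup>2) (x\<^sup>2)) = of_real (crossing_diag r x)"
  by (simp_all add: diag_coord_real_point crossing_diag_def add.commute)

lemma crossing_diag_bounds:
  assumes "0 < r" "r < 1" "\<bar>x\<bar> < 1" shows "0 \<le> crossing_diag r x" "crossing_diag r x < 1"
proof -
  have "x\<^sup>2 < 1" "(swap_real r x)\<^sup>2 < 1"
    using assms abs_swap_real_less_1[OF assms] by (simp_all add: abs_square_less_1)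
  then show "0 \<le> crossing_diag r x" "crossing_diag r x < 1" by (auto simp: crossing_diag_def)
qed

text \<open>Multiplying by the test function, which takes the same value at two points that differ by exchange of coordinates,
turns boundedness of differences in the space into decay of differences for the multiplier.\<close>

lemma crossing_multiplier_decay:
  assumes r: "0 < r" "r < 1" and \<phi>: "\<phi> \<in> disc_multipliers (crossing_disc r)"
  shows "\<exists>C. \<forall>x. \<bar>x\<bar> < 1 \<longrightarrow>
    cmod (\<phi> (of_real x) - \<phi> (of_real (swap_real r x))) * (1 - crossing_diag r x) powr (-3/8) \<le> C"
proof -
  obtain \<Psi> where \<Psi>: "\<Psi> \<in> drury_arveson_multipliers" "\<And>z. z \<in> ball 0 1 \<Longrightarrow> \<phi> z = \<Psi> (crossing_disc r z)"
    using disc_multipliers_pullback[OF crossing_disc_inj[OF r] \<phi>] by blast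
  define g where "g = (\<lambda>z\<in>ball 0 1. \<Sum>n. of_real (real (Suc n) powr (-5/8)) * diag_coord z ^ n)"
  have "g \<in> drury_arveson_space"
    unfolding g_def by (rule diag_power_series_mem[OF test_coeff_square_summable])
  then have "(\<lambda>z\<in>ball 0 1. \<Psi> z * g z) \<in> drury_arveson_space"
    using \<Psi>(1) unfolding drury_arveson_multipliers_def multipliers_def by blast
  from swap_difference_bounded[OF this] obtain C where
    C: "\<And>p q. 0 \<le> p \<Longrightarrow> p < 1 \<Longrightarrow> 0 \<le> q \<Longrightarrow> q < 1 \<Longrightarrow>
      cmod ((\<lambda>z\<in>ball 0 1. \<Psi> z * g z) (real_point p q) - (\<lambda>z\<in>ball 0 1. \<Psi> z * g z) (real_point q p)) \<le> C"
    by blast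
  have "cmod (\<phi> (of_real x) - \<phi> (of_real (swap_real r x))) * (1 - crossing_diag r x) powr (-3/8) \<le> 4 * C"
    if x: "\<bar>x\<bar> < 1" for x
  proof -
    define p q u where "p = x\<^sup>2" and "q = (swap_real r x)\<^sup>2" and "u = crossing_diag r x"
    define G where "G = (\<Sum>n. real (Suc n) powr (-5/8) * u ^ n)"
    have sw: "\<bar>swap_real r x\<bar> < 1" by (rule abs_swap_real_less_1[OF r x])
    have pq: "0 \<le> p" "p < 1" "0 \<le> q" "q < 1" using x sw by (simp_all add: p_def q_def abs_square_less_1)
    have u: "0 \<le> u" "u < 1" unfolding u_def by (rule crossing_diag_bounds[OF r x])+
    have ball: "real_point p q \<in> ball 0 1" "real_point q p \<in> ball 0 1" using pq real_point_in_ball by blast+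
    have "(\<Sum>n. of_real (real (Suc n) powr (-5/8)) * complex_of_real u ^ n) = of_real G"
      unfolding G_def suminf_of_real[OF test_series_summable[OF u]] by simp
    then have g: "g (real_point p q) = of_real G" "g (real_point q p) = of_real G"
      using ball diag_coord_crossing[where r = r and x = x] by (simp_all add: g_def p_def q_def u_def)
    have \<phi>x: "\<phi> (of_real x) = \<Psi> (real_point p q)"
      using \<Psi>(2)[of "of_real x"] x by (simp add: crossing_disc_real p_def q_def)
    have \<phi>s: "\<phi> (of_real (swap_real r x)) = \<Psi> (real_point q p)"
      using \<Psi>(2)[of "of_real (swap_real r x)"] sw
      by (simp add: crossing_disc_real p_def q_def swap_real_involution[OF r x])
    have "(1 - u) powr (-3/8) / 4 \<le> G" unfolding G_def by (rule test_series_lower_bound[OF u])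
    then have G: "(1 - u) powr (-3/8) \<le> 4 * G" by simp
    then have G0: "0 \<le> G" using powr_ge_zero[of "1 - u" "-3/8"] by linarith
    have "(\<Psi> (real_point p q) - \<Psi> (real_point q p)) * of_real G
        = (\<lambda>z\<in>ball 0 1. \<Psi> z * g z) (real_point p q) - (\<lambda>z\<in>ball 0 1. \<Psi> z * g z) (real_point q p)"
      using ball g by (simp add: algebra_simps)
    then have "cmod ((\<Psi> (real_point p q) - \<Psi> (real_point q p)) * of_real G) \<le> C"
      using C[OF pq] by simp
    then have "cmod (\<Psi> (real_point p q) - \<Psi> (real_point q p)) * G \<le> C"
      using G0 by (simp add: norm_mult)
    moreover have "cmod (\<Psi> (real_point p q) - \<Psi> (real_point q p)) * (1 - u) powr (-3/8)
        \<le> cmod (\<Psi> (real_point p q) - \<Psi> (real_point q p)) * (4 * G)"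
      by (intro mult_left_mono G) simp
    ultimately show ?thesis unfolding \<phi>x \<phi>s u_def[symmetric] by linarith
  qed
  then show ?thesis by blast
qed

lemma fourth_root_disc_multiplier:
  assumes s: "0 < s" "s < 1"
  obtains \<phi> where "\<phi> \<in> disc_multipliers (crossing_disc s)"
    "\<And>x. \<bar>x\<bar> < 1 \<Longrightarrow> \<phi> (of_real x) = of_real ((1 - crossing_diag s x) powr (1/4))"
proof -
  obtain b :: "nat \<Rightarrow> real" where b: "summable (\<lambda>n. \<bar>b n\<bar>)"
    "\<And>u. 0 \<le> u \<Longrightarrow> u < 1 \<Longrightarrow> (\<lambda>n. b n * u ^ n) sums (1 - u) powr (1/4)"
    using fourth_root_series by blast
  define \<Phi> where "\<Phi> = (\<lambda>z\<in>ball 0 1. \<Sum>n. of_real (b n) * diag_coord z ^ n)"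
  have \<Phi>: "\<Phi> \<in> drury_arveson_multipliers"
    unfolding \<Phi>_def by (rule diag_power_series_multiplier) (use b(1) in simp)
  show ?thesis
  proof
    show "(\<lambda>z\<in>ball 0 1. \<Phi> (crossing_disc s z)) \<in> disc_multipliers (crossing_disc s)"
      by (rule pullback_in_disc_multipliers[OF crossing_disc_inj[OF s] \<Phi>])
    fix x :: real assume x: "\<bar>x\<bar> < 1"
    have "crossing_disc s (of_real x) \<in> ball 0 1"
      unfolding crossing_disc_real using x abs_swap_real_less_1[OF s x]
      by (intro real_point_in_ball) (simp_all add: abs_square_less_1)
    moreover have "(\<lambda>n. of_real (b n) * complex_of_real (crossing_diag s x) ^ n)
        sums of_real ((1 - crossing_diag s x) powr (1/4))"
      using sums_of_real[OF b(2)[OF crossing_diag_bounds[OF s x]]] by simp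
    ultimately show "(\<lambda>z\<in>ball 0 1. \<Phi> (crossing_disc s z)) (of_real x) = of_real ((1 - crossing_diag s x) powr (1/4))"
      using x by (simp add: \<Phi>_def crossing_disc_real diag_coord_crossing sums_iff)
  qed
qed

section \<open>Distinguishing the parameters\<close>

text \<open>The quotient of \<open>1 - crossing_diag r x\<close> by \<open>1 - x\<^sup>2\<close>, continued to \<open>x = \<plusminus>1\<close>: the rate at which the disc
approaches the crossing point.\<close>

definition boundary_factor :: "real \<Rightarrow> real \<Rightarrow> real" where
  "boundary_factor r x = (1 + (1 - r\<^sup>2) / (1 - r * x)\<^sup>2) / 2"

lemma one_minus_crossing_diag:
  assumes "0 < r" "r < 1" "\<bar>x\<bar> < 1"
  shows "1 - crossing_diag r x = (1 - x\<^sup>2) * boundary_factor r x"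
proof -
  have "1 - crossing_diag r x = ((1 - x\<^sup>2) + (1 - (swap_real r x)\<^sup>2)) / 2"
    by (simp add: crossing_diag_def field_simps)
  then show ?thesis
    unfolding one_minus_swap_real_square[OF assms] by (simp add: boundary_factor_def algebra_simps)
qed

lemma boundary_factor_pos:
  assumes "0 < r" "r < 1" "\<bar>x\<bar> \<le> 1" shows "0 < boundary_factor r x"
proof -
  have "r\<^sup>2 < 1" using assms by (simp add: abs_square_less_1)
  then have "0 \<le> (1 - r\<^sup>2) / (1 - r * x)\<^sup>2" by simp
  then show ?thesis by (simp add: boundary_factor_def)
qed

lemma boundary_factor_values:
  assumes "0 < r" "r < 1"
  shows "boundary_factor r 1 = 1 / (1 - r)" "boundary_factor r (-1) = 1 / (1 + r)"
proof -
  have "1 - r\<^sup>2 = (1 - r) * (1 + r)" by (simp add: power2_eq_square algebra_simps)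
  then show "boundary_factor r 1 = 1 / (1 - r)" "boundary_factor r (-1) = 1 / (1 + r)"
    using assms by (simp_all add: boundary_factor_def power2_eq_square divide_simps)
qed

text \<open>After the common power of \<open>1 - x\<^sup>2\<close> is taken out, the decay estimate reads
\<open>E x \<le> C (1 - x\<^sup>2) powr (1/8)\<close> with E continuous at 1. In E the values at x and at \<open>\<sigma>\<^sub>r(x)\<close>
contribute the limits \<open>1 / (1 - s)\<close> and \<open>(1 + r) / ((1 - r) (1 + s))\<close>, which are equal only if \<open>r = s\<close>.\<close>

lemma fourth_root_not_crossing_multiplier:
  assumes r: "0 < r" "r < 1" and s: "0 < s" "s < 1" and "r \<noteq> s"
    and \<phi>: "\<And>x. \<bar>x\<bar> < 1 \<Longrightarrow> \<phi> (of_real x) = of_real ((1 - crossing_diag s x) powr (1/4))"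
  shows "\<phi> \<notin> disc_multipliers (crossing_disc r)"
proof
  assume "\<phi> \<in> disc_multipliers (crossing_disc r)"
  from crossing_multiplier_decay[OF r this] obtain C where C: "\<And>x. \<bar>x\<bar> < 1 \<Longrightarrow>
    cmod (\<phi> (of_real x) - \<phi> (of_real (swap_real r x))) * (1 - crossing_diag r x) powr (-3/8) \<le> C"
    by blast
  define R where "R x = (1 - r\<^sup>2) / (1 - r * x)\<^sup>2 * boundary_factor s (swap_real r x)" for x
  define E where "E x = \<bar>boundary_factor s x powr (1/4) - R x powr (1/4)\<bar> * boundary_factor r x powr (-3/8)" for x
  have r2: "0 < 1 - r\<^sup>2" using r by (simp add: abs_square_less_1)
  have le: "E x \<le> C * (1 - x\<^sup>2) powr (1/8)" if x: "\<bar>x\<bar> < 1" for x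
  proof -
    define t where "t = 1 - x\<^sup>2"
    have t: "t > 0" using x by (simp add: t_def abs_square_less_1)
    have sw: "\<bar>swap_real r x\<bar> < 1" by (rule abs_swap_real_less_1[OF r x])
    have pos: "0 < boundary_factor s x" "0 < boundary_factor r x" "0 < R x"
      using boundary_factor_pos r s x sw r2 swap_real_denominator[OF r x] by (auto simp: R_def)
    have 1: "1 - crossing_diag s x = t * boundary_factor s x"
      unfolding t_def by (rule one_minus_crossing_diag[OF s x])
    have 2: "1 - crossing_diag s (swap_real r x) = t * R x"
      unfolding one_minus_crossing_diag[OF s sw] one_minus_swap_real_square[OF r x] R_def t_def
      by (simp only: mult.assoc)
    have 3: "1 - crossing_diag r x = t * boundary_factor r x"
      unfolding t_def by (rule one_minus_crossing_diag[OF r x])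
    have "cmod (\<phi> (of_real x) - \<phi> (of_real (swap_real r x)))
        = \<bar>(t * boundary_factor s x) powr (1/4) - (t * R x) powr (1/4)\<bar>"
      unfolding \<phi>[OF x] \<phi>[OF sw] 1 2 of_real_diff[symmetric] norm_of_real ..
    also have "\<dots> = t powr (1/4) * \<bar>boundary_factor s x powr (1/4) - R x powr (1/4)\<bar>"
      using t pos by (simp add: powr_mult abs_mult flip: right_diff_distrib)
    finally have "t powr (1/4) * t powr (-3/8) * E x \<le> C"
      using C[OF x] t pos unfolding 3 E_def by (simp add: powr_mult mult_ac)
    moreover have "t powr (1/4) * t powr (-3/8) = t powr (-1/8)" by (simp flip: powr_add)
    moreover have "t powr (1/8) * t powr (-1/8) = 1" using t by (simp flip: powr_add)
    ultimately have "t powr (1/8) * (t powr (-1/8) * E x) \<le> t powr (1/8) * C"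
      by (intro mult_left_mono) auto
    then have "t powr (1/8) * t powr (-1/8) * E x \<le> C * t powr (1/8)"
      by (simp only: mult.assoc mult.commute[of C])
    then show ?thesis
      unfolding \<open>t powr (1/8) * t powr (-1/8) = 1\<close> t_def[symmetric] by simp
  qed
  have sw1: "swap_real r 1 = -1" using r by (simp add: swap_real_def field_simps)
  have den: "1 - r * 1 \<noteq> 0" "1 - s * 1 \<noteq> 0" "1 - s * swap_real r 1 \<noteq> 0" using r s by (auto simp: sw1)
  have sw_lim: "(swap_real r \<longlongrightarrow> swap_real r 1) (at_left 1)"
    unfolding swap_real_def using den by (intro tendsto_intros)
  have bf_r: "(boundary_factor r \<longlongrightarrow> boundary_factor r 1) (at_left 1)"
    unfolding boundary_factor_def using den by (intro tendsto_intros) auto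
  have bf_s: "(boundary_factor s \<longlongrightarrow> boundary_factor s 1) (at_left 1)"
    unfolding boundary_factor_def using den by (intro tendsto_intros) auto
  have bf_sw: "((\<lambda>x. boundary_factor s (swap_real r x)) \<longlongrightarrow> boundary_factor s (swap_real r 1)) (at_left 1)"
    unfolding boundary_factor_def using den by (intro tendsto_intros sw_lim) auto
  have R_lim: "(R \<longlongrightarrow> R 1) (at_left 1)"
    unfolding R_def using den by (intro tendsto_intros bf_sw) auto
  have pos1: "boundary_factor r 1 > 0" "boundary_factor s 1 > 0" "R 1 > 0"
    using boundary_factor_pos[OF r] boundary_factor_pos[OF s] r2 den by (auto simp: R_def sw1)
  have "(E \<longlongrightarrow> E 1) (at_left 1)"
    unfolding E_def using pos1 by (intro tendsto_intros bf_r bf_s R_lim) auto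
  moreover have "((\<lambda>x. C * (1 - x\<^sup>2) powr (1/8)) \<longlongrightarrow> C * 0) (at_left 1)"
  proof -
    have "((\<lambda>x::real. 1 - x\<^sup>2) \<longlongrightarrow> 1 - 1\<^sup>2) (at_left 1)" by (intro tendsto_intros)
    then have "((\<lambda>x::real. 1 - x\<^sup>2) \<longlongrightarrow> 0) (at_left 1)" by simp
    moreover have "\<forall>\<^sub>F x in at_left (1::real). 0 \<le> 1 - x\<^sup>2"
      by (rule eventually_at_leftI[of 0]) (auto simp: abs_square_le_1)
    ultimately have "((\<lambda>x::real. (1 - x\<^sup>2) powr (1/8)) \<longlongrightarrow> 0 powr (1/8)) (at_left 1)"
      by (intro tendsto_powr2 tendsto_const) auto
    then show ?thesis by (intro tendsto_mult tendsto_const) simp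
  qed
  moreover have "\<forall>\<^sub>F x in at_left 1. E x \<le> C * (1 - x\<^sup>2) powr (1/8)"
    by (rule eventually_at_leftI[of 0]) (auto intro!: le)
  ultimately have "E 1 \<le> C * 0" by (intro tendsto_le[of "at_left (1::real)"]) auto
  moreover have "E 1 > 0"
  proof -
    have "R 1 = (1 + r) / (1 - r) / (1 + s)"
    proof -
      have "1 - r\<^sup>2 = (1 - r) * (1 + r)" by (simp add: power2_eq_square algebra_simps)
      then show ?thesis unfolding R_def sw1 boundary_factor_values[OF s]
        using r s by (simp add: power2_eq_square)
    qed
    then have "boundary_factor s 1 \<noteq> R 1"
      unfolding boundary_factor_values[OF s] using r s \<open>r \<noteq> s\<close> by (simp add: field_simps)
    then have "boundary_factor s 1 powr (1/4) \<noteq> R 1 powr (1/4)"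
      using pos1 powr_less_mono2[of "1/4" "boundary_factor s 1" "R 1"]
        powr_less_mono2[of "1/4" "R 1" "boundary_factor s 1"] by linarith
    then show ?thesis unfolding E_def using pos1 by simp
  qed
  ultimately show False by simp
qed

theorem theorem5:
  fixes r s :: real
  assumes "r \<in> {0<..<1}" and "s \<in> {0<..<1}" and "r \<noteq> s"
  shows "disc_multipliers (crossing_disc r) \<noteq> disc_multipliers (crossing_disc s)"
proof -
  have r: "0 < r" "r < 1" and s: "0 < s" "s < 1" using assms by auto
  obtain \<phi> where "\<phi> \<in> disc_multipliers (crossing_disc s)"
    "\<And>x. \<bar>x\<bar> < 1 \<Longrightarrow> \<phi> (of_real x) = of_real ((1 - crossing_diag s x) powr (1/4))"
    using fourth_root_disc_multiplier[OF s] by blast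
  then show ?thesis using fourth_root_not_crossing_multiplier[OF r s assms(3)] by blast
qed

end
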